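(* Let $H$ be a compact Hausdorff space, $Y$ a Banach space, $T:C(H)\to Y$ a bounded linear operator with representing measure $m$ (i.e. $m\leftrightarrow T$), and let $\mu$ be a measure on $\beta(H)$ with $m\ll\mu$. Then the following are equivalent: (1) $m_\pi\to m$ in semivariation norm (limit along the net of finite partitions $\pi$ of $H$ directed by refinement); (2) $m$ has relatively (norm) compact range; (3) $T$ is compact. If, in addition, $\mu$ is regular, then (1)--(3) are equivalent to (4) $T_\pi\to T$ in operator norm.
   Context: Banach spaces are real. $C(H)$ is the space of continuous real functions on $H$ with the sup norm; $\beta(H)$ is the Borel $\sigma$-algebra of $H$. A "measure" on $\beta(H)$ is a countably additive set function $\mu:\beta(H)\to[0,\infty)$; a "vector measure" is a (finitely) additive set function into a Banach space. Representing measure: for every bounded linear $T:C(H)\to Y$ there is a unique weakly regular finitely additive set function $m:\beta(H)\to L(\mathbf R,Y^{**})=Y^{**}$ of finite semivariation with $T(f)=\int f\,dm$ for all $f\in C(H)$ (weakly regular: for each $y^*\in Y^*$, $A\mapsto \langle y^*, m(A)\rangle$ is a regular countably additive real Borel measure). Write $m\leftrightarrow T$. The semivariation of $m$ is $\widetilde m(A)=\sup\|\sum_i r_i\, m(A_i)\|$, the supremum over finite partitions $\{A_i\}$ of $A$ into sets of $\beta(H)$ and reals $|r_i|\le 1$ (this is the usual scalar semivariation $\|m\|(A)$). Convergence in semivariation norm means $\widetilde{(m_\pi-m)}(H)\to 0$. $m\ll\mu$ means $\lim_{\mu(A)\to0}\|m(A)\|=0$. For a finite partition $\pi$ of $H$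 into sets of $\beta(H)$, define (with the convention $0/0=0$, i.e. terms with $\mu(A)=0$ are omitted) $$m_\pi(B)=\sum_{A\in\pi}\frac{\mu(A\cap B)}{\mu(A)}\,m(A),\qquad T_\pi(f)=\sum_{A\in\pi} \frac{\int_A f\,d\mu}{\mu(A)}\, m(A).$$ $Y$ is regarded as a subspace of $Y^{**}$ when $T_\pi$ and $T$ are compared. Partitions are directed by refinement, and $T_\pi\to T$ means convergence of this net in operator norm. *)

theory Defs
  imports "HOL-Analysis.Analysis"
begin

type_synonym 'y bidual = "('y \<Rightarrow>\<^sub>L real) \<Rightarrow>\<^sub>L real"

text \<open>The canonical embedding of \<open>Y\<close> into \<open>Y\<^sup>*\<^sup>*\<close>: \<open>to_bidual y\<close> maps \<open>y\<^sup>*\<close> to \<open>y\<^sup>* y\<close>.\<close>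

definition to_bidual :: "'y::real_normed_vector \<Rightarrow> 'y bidual" where
  "to_bidual y = blinfun.prod_left y"

lemma to_bidual_apply [simp]: "blinfun_apply (to_bidual y) \<phi> = blinfun_apply \<phi> y"
  by (simp add: to_bidual_def)

text \<open>
  Set functions are total functions on \<open>'h set\<close>; only their values on Borel sets matter.
  Following \<open>partition_on\<close>, the members of a partition are nonempty.
\<close>

definition borel_partition :: "'h::topological_space set \<Rightarrow> 'h set set \<Rightarrow> bool" where
  "borel_partition A P \<longleftrightarrow> finite P \<and> P \<subseteq> sets borel \<and> partition_on A P"

definition partition_net :: "'h::topological_space set set filter" where
  "partition_net = (INF P\<in>{P. borel_partition UNIV P}.
     principal {Q. borel_partition UNIV Q \<and> refines UNIV Q P})"

lemma borel_partition_trivial: "borel_partition UNIV {UNIV}"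
  by (auto simp: borel_partition_def partition_on_def)

lemma borel_partition_common_refinement:
  assumes "borel_partition UNIV P" "borel_partition UNIV Q"
  obtains R where "borel_partition UNIV R" "refines UNIV R P" "refines UNIV R Q"
proof
  let ?R = "(\<lambda>(A, B). A \<inter> B) ` (P \<times> Q) - {{}}"
  have *: "\<Union>P = UNIV" "\<Union>Q = UNIV" "disjoint P" "disjoint Q"
    using assms by (auto simp: borel_partition_def partition_on_def)
  have "\<exists>A\<in>P. \<exists>B\<in>Q. x \<in> A \<inter> B" for x
    using *(1,2) by (metis IntI UNIV_I UnionE)
  then have un: "\<Union>?R = UNIV" by blast
  have "disjoint ?R"
    unfolding pairwise_def
  proof (intro ballI impI)
    fix X Y assume "X \<in> ?R" "Y \<in> ?R" "X \<noteq> Y"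
    then obtain A B C D where XY: "X = A \<inter> B" "Y = C \<inter> D"
      and mem: "A \<in> P" "B \<in> Q" "C \<in> P" "D \<in> Q" by auto
    with \<open>X \<noteq> Y\<close> have "A \<noteq> C \<or> B \<noteq> D" by auto
    then have "disjnt A C \<or> disjnt B D"
      using mem *(3,4) by (meson pairwiseD)
    then show "disjnt X Y"
      by (auto simp: XY disjnt_def)
  qed
  with un have R: "partition_on UNIV ?R"
    by (auto simp: partition_on_def)
  then show "borel_partition UNIV ?R"
    using assms by (auto simp: borel_partition_def)
  show "refines UNIV ?R P" "refines UNIV ?R Q"
    using R assms by (auto simp: refines_def borel_partition_def)
qed

lemma eventually_partition_net:
  "eventually \<Phi> partition_net \<longleftrightarrow>
     (\<exists>P. borel_partition UNIV P \<and>
        (\<forall>Q. borel_partition UNIV Q \<longrightarrow> refines UNIV Q P \<longrightarrow> \<Phi> Q))"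
  unfolding partition_net_def
proof (subst eventually_INF_base)
  show "{P :: 'a set set. borel_partition UNIV P} \<noteq> {}"
    using borel_partition_trivial by blast
next
  fix P Q :: "'a set set"
  assume "P \<in> {P. borel_partition UNIV P}" "Q \<in> {P. borel_partition UNIV P}"
  then obtain R where "borel_partition UNIV R" "refines UNIV R P" "refines UNIV R Q"
    using borel_partition_common_refinement[of P Q] by auto
  then show "\<exists>x\<in>{P. borel_partition UNIV P}.
      principal {Q. borel_partition UNIV Q \<and> refines UNIV Q x}
      \<le> inf (principal {Q. borel_partition UNIV Q \<and> refines UNIV Q P})
          (principal {R. borel_partition UNIV R \<and> refines UNIV R Q})"
    by (intro bexI[of _ R]) (auto intro: refines_trans)
qed (auto simp: eventually_principal)

definition semivariation ::
    "('h::topological_space set \<Rightarrow> 'v::real_normed_vector) \<Rightarrow> 'h set \<Rightarrow> ennreal" where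
  "semivariation m A =
     (SUP (P, r) \<in> {(P, r :: 'h set \<Rightarrow> real). borel_partition A P \<and> (\<forall>B\<in>P. \<bar>r B\<bar> \<le> 1)}.
        ennreal (norm (\<Sum>B\<in>P. r B *\<^sub>R m B)))"

definition signed_borel_measure :: "('h::topological_space set \<Rightarrow> real) \<Rightarrow> bool" where
  "signed_borel_measure \<nu> \<longleftrightarrow>
     (\<forall>A. range A \<subseteq> sets borel \<longrightarrow> disjoint_family A \<longrightarrow> (\<lambda>i::nat. \<nu> (A i)) sums \<nu> (\<Union>i. A i))"

text \<open>
  Regularity of a real set function, possibly signed (Dunford--Schwartz III.5.11): the smallness
  condition on all Borel subsets of \<open>U - K\<close> says that the total variation of \<open>U - K\<close> is small.
  Compact sets are used for inner approximation; in a compact Hausdorff space these are the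
  closed sets.
\<close>

definition regular_set_function :: "('h::topological_space set \<Rightarrow> real) \<Rightarrow> bool" where
  "regular_set_function \<nu> \<longleftrightarrow>
     (\<forall>A\<in>sets borel. \<forall>\<epsilon>>0. \<exists>K U. compact K \<and> open U \<and> K \<subseteq> A \<and> A \<subseteq> U \<and>
        (\<forall>B\<in>sets borel. B \<subseteq> U - K \<longrightarrow> \<bar>\<nu> B\<bar> < \<epsilon>))"

definition weakly_regular ::
    "('h::topological_space set \<Rightarrow> 'y::real_normed_vector bidual) \<Rightarrow> bool" where
  "weakly_regular m \<longleftrightarrow>
     (\<forall>\<phi>. signed_borel_measure (\<lambda>A. blinfun_apply (m A) \<phi>) \<and>
          regular_set_function (\<lambda>A. blinfun_apply (m A) \<phi>))"

text \<open>
  Integration of uniform limits of simple functions against a finitely additive set function of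
  finite semivariation.
\<close>

definition simple_vector_integral ::
    "('h::topological_space set \<Rightarrow> 'v::real_normed_vector) \<Rightarrow> ('h \<Rightarrow> real) \<Rightarrow> 'v" where
  "simple_vector_integral m s = (\<Sum>r\<in>range s. r *\<^sub>R m (s -` {r}))"

definition has_vector_integral ::
    "('h::topological_space set \<Rightarrow> 'v::real_normed_vector) \<Rightarrow> ('h \<Rightarrow> real) \<Rightarrow> 'v \<Rightarrow> bool" where
  "has_vector_integral m f I \<longleftrightarrow>
     (\<exists>s :: nat \<Rightarrow> 'h \<Rightarrow> real. (\<forall>n. simple_function borel (s n)) \<and>
        uniform_limit UNIV s f sequentially \<and>
        (\<lambda>n. simple_vector_integral m (s n)) \<longlonglongrightarrow> I)"

text \<open>
  \<open>m \<leftrightarrow> T\<close>. On a compact space \<open>'h\<close>, the bounded continuous functions \<open>'h \<Rightarrow>\<^sub>C real\<close>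
  are all continuous functions, with the sup norm.
\<close>

definition representing_measure ::
    "('h::topological_space set \<Rightarrow> 'y::real_normed_vector bidual) \<Rightarrow>
     (('h \<Rightarrow>\<^sub>C real) \<Rightarrow>\<^sub>L 'y) \<Rightarrow> bool" where
  "representing_measure m T \<longleftrightarrow>
     Measure_Space.additive (sets borel) m \<and>
     weakly_regular m \<and>
     semivariation m UNIV < \<infinity> \<and>
     (\<forall>f. has_vector_integral m (apply_bcontfun f) (to_bidual (blinfun_apply T f)))"

definition vm_abs_continuous ::
    "('h::topological_space set \<Rightarrow> 'v::real_normed_vector) \<Rightarrow> 'h measure \<Rightarrow> bool" where
  "vm_abs_continuous m \<mu> \<longleftrightarrow>
     (\<forall>\<epsilon>>0. \<exists>\<delta>>0. \<forall>A\<in>sets borel. measure \<mu> A < \<delta> \<longrightarrow> norm (m A) < \<epsilon>)"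

text \<open>In both definitions the convention \<open>x / 0 = 0\<close> drops the terms with \<open>\<mu> A = 0\<close>.\<close>

definition averaged_measure ::
    "'h measure \<Rightarrow> ('h set \<Rightarrow> 'v::real_normed_vector) \<Rightarrow> 'h set set \<Rightarrow> 'h set \<Rightarrow> 'v" where
  "averaged_measure \<mu> m P B = (\<Sum>A\<in>P. (measure \<mu> (A \<inter> B) / measure \<mu> A) *\<^sub>R m A)"

definition averaged_operator ::
    "'h::topological_space measure \<Rightarrow> ('h set \<Rightarrow> 'v::real_normed_vector) \<Rightarrow> 'h set set \<Rightarrow>
     ('h \<Rightarrow>\<^sub>C real) \<Rightarrow> 'v" where
  "averaged_operator \<mu> m P f =
     (\<Sum>A\<in>P. (set_lebesgue_integral \<mu> A (apply_bcontfun f) / measure \<mu> A) *\<^sub>R m A)"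

text \<open>Hence \<open>onorm\<close> is the genuine operator norm on differences of such operators.\<close>

lemma bounded_linear_averaged_operator:
  fixes \<mu> :: "'h::topological_space measure" and m :: "'h set \<Rightarrow> 'v::real_normed_vector"
  assumes "finite_measure \<mu>" and sets: "sets \<mu> = sets borel" and P: "borel_partition UNIV P"
  shows "bounded_linear (averaged_operator \<mu> m P)"
proof -
  interpret finite_measure \<mu> by fact
  have bl: "bounded_linear (\<lambda>f::'h \<Rightarrow>\<^sub>C real. set_lebesgue_integral \<mu> A (apply_bcontfun f))"
    if "A \<in> sets borel" for A
  proof -
    have A: "A \<in> sets \<mu>" using that sets by simp
    have meas: "apply_bcontfun f \<in> borel_measurable \<mu>" for f :: "'h \<Rightarrow>\<^sub>C real"
      using borel_measurable_continuous_onI[of "apply_bcontfun f"] measurable_cong_sets[OF sets refl]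
      by auto
    have int: "set_integrable \<mu> A (apply_bcontfun f)" for f :: "'h \<Rightarrow>\<^sub>C real"
      unfolding set_integrable_def
      by (rule integrable_const_bound[where B = "norm f"])
        (use A meas in \<open>auto simp: indicator_def norm_bounded[of f, unfolded real_norm_def]\<close>)
    show ?thesis
    proof (rule bounded_linear_intro[where K = "measure \<mu> (space \<mu>)"])
      fix f g :: "'h \<Rightarrow>\<^sub>C real" and c :: real
      show "set_lebesgue_integral \<mu> A (apply_bcontfun (f + g)) =
          set_lebesgue_integral \<mu> A (apply_bcontfun f) + set_lebesgue_integral \<mu> A (apply_bcontfun g)"
        using set_integral_add(2)[OF int[of f] int[of g]] by simp
      show "set_lebesgue_integral \<mu> A (apply_bcontfun (c *\<^sub>R f)) =
          c *\<^sub>R set_lebesgue_integral \<mu> A (apply_bcontfun f)"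
        by simp
      have "norm (set_lebesgue_integral \<mu> A (apply_bcontfun f))
          \<le> (\<integral>x. norm (indicator A x *\<^sub>R apply_bcontfun f x) \<partial>\<mu>)"
        unfolding set_lebesgue_integral_def by (rule integral_norm_bound)
      also have "\<dots> \<le> (\<integral>x. norm f \<partial>\<mu>)"
        using int[of f]
        by (intro integral_mono)
          (auto simp: set_integrable_def indicator_def norm_bounded[of f, unfolded real_norm_def])
      also have "\<dots> = norm f * measure \<mu> (space \<mu>)" by (simp add: mult.commute)
      finally show "norm (set_lebesgue_integral \<mu> A (apply_bcontfun f))
          \<le> norm f * measure \<mu> (space \<mu>)" .
    qed
  qed
  show ?thesis
    unfolding averaged_operator_def [abs_def] divide_inverse
    using P
    by (intro bounded_linear_sum
        bounded_linear_compose[OF bounded_linear_scaleR_left]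
        bounded_linear_compose[OF bounded_linear_mult_left] bl)
      (auto simp: borel_partition_def)
qed

definition compact_operator :: "('a::real_normed_vector \<Rightarrow>\<^sub>L 'b::real_normed_vector) \<Rightarrow> bool" where
  "compact_operator T \<longleftrightarrow> (\<forall>S. bounded S \<longrightarrow> compact (closure (blinfun_apply T ` S)))"

end

theory Submission
  imports Defs
begin

text \<open>
  The proof goes around the cycle \<open>(1) \<longrightarrow> (4) \<longrightarrow> (3) \<longrightarrow> (2) \<longrightarrow> (1)\<close>. Throughout, \<open>m\<close> is studied
  through its scalar measures \<open>A \<mapsto> m A \<phi>\<close>, with \<open>\<phi>\<close> in the dual of \<open>Y\<close>. By \<open>m \<lless> \<mu>\<close> each of them has a
  density \<open>g \<phi>\<close> in \<open>L\<^sup>1(\<mu>)\<close> (lemma \<open>bidual_measure_has_density\<close>), and averaging over a partition replaces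
  \<open>g \<phi>\<close> by its conditional expectation.

  \<open>(1) \<longrightarrow> (4)\<close>. The operator \<open>T\<^sub>Q\<close> is integration against the averaged measure, so the operator norm of
  \<open>T\<^sub>Q - T\<close> is at most the semivariation of the difference of the measures
  (lemma \<open>norm_averaged_operator_diff_le\<close>).

  \<open>(4) \<longrightarrow> (3)\<close>. The \<open>T\<^sub>Q\<close> have finite rank, and norm limits of finite-rank operators are compact. The limit
  is taken in the bidual; to return to \<open>Y\<close> one needs that the canonical embedding is isometric, which is
  the Hahn--Banach theorem.

  \<open>(3) \<longrightarrow> (2)\<close>. By regularity of the scalar measures and Urysohn's lemma, every \<open>m A\<close> is in the weak*
  closure of the image of the unit ball under \<open>T\<close>. The norm closure of this image is compact, hence already
  weak* closed in the bidual, so it contains the whole range of \<open>m\<close>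
  (lemmas \<open>bidual_in_compact_image\<close> and \<open>compact_range_of_compact_operator\<close>).

  \<open>(2) \<longrightarrow> (1)\<close>. For one density the averages converge in \<open>L\<^sup>1\<close>: averaging is a contraction, and it is
  exact for a simple function as soon as the partition refines its level sets
  (lemma \<open>eventually_averaging_error_le\<close>). On a compact range the functionals of the unit ball are, up
  to a small error, finitely many (lemma \<open>finite_functional_net\<close>); therefore the densities \<open>g \<phi>\<close> form a
  totally bounded family in \<open>L\<^sup>1\<close> and the convergence is uniform, which is convergence in semivariation.
\<close>

section \<open>Norming functionals\<close>

definition sublinear :: "('a::real_vector \<Rightarrow> real) \<Rightarrow> bool" where
  "sublinear p \<longleftrightarrow> (\<forall>x y. p (x + y) \<le> p x + p y) \<and> (\<forall>c\<ge>0. \<forall>x. p (c *\<^sub>R x) = c * p x)"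

lemma sublinear_add: "sublinear p \<Longrightarrow> p (x + y) \<le> p x + p y"
  by (simp add: sublinear_def)

lemma sublinear_scaleR: "sublinear p \<Longrightarrow> c \<ge> 0 \<Longrightarrow> p (c *\<^sub>R x) = c * p x"
  by (simp add: sublinear_def)

lemma sublinear_zero: "sublinear p \<Longrightarrow> p 0 = 0"
  using sublinear_scaleR[of p 0 0] by simp

lemma sublinear_neg: "sublinear p \<Longrightarrow> - p (- x) \<le> p x"
  using sublinear_add[of p x "-x"] sublinear_zero[of p] by simp

text \<open>
  A sublinear functional below \<open>p\<close> that is at most \<open>- p y\<close> at \<open>- y\<close>. It serves twice: if \<open>p\<close> is minimal, it
  coincides with \<open>p\<close> for every \<open>y\<close>, which makes \<open>p\<close> additive; if \<open>p\<close> is the norm, every linear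
  functional below it attains the norm at \<open>y\<close>.
\<close>

definition tilt :: "('a::real_vector \<Rightarrow> real) \<Rightarrow> 'a \<Rightarrow> 'a \<Rightarrow> real" where
  "tilt p y x = (INF t\<in>{0..}. p (x + t *\<^sub>R y) - t * p y)"

lemma tilt_le:
  assumes "sublinear p" "t \<ge> 0"
  shows "tilt p y x \<le> p (x + t *\<^sub>R y) - t * p y"
  unfolding tilt_def
proof (rule cINF_lower)
  show "bdd_below ((\<lambda>t. p (x + t *\<^sub>R y) - t * p y) ` {0..})"
  proof (rule bdd_belowI2)
    fix t :: real assume "t \<in> {0..}"
    then show "- p (- x) \<le> p (x + t *\<^sub>R y) - t * p y"
      using sublinear_add[OF assms(1), of "x + t *\<^sub>R y" "-x"] sublinear_scaleR[OF assms(1), of t y]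
      by simp
  qed
qed (use assms in auto)

lemma tilt_le_self: "sublinear p \<Longrightarrow> tilt p y x \<le> p x"
  using tilt_le[of p 0 y x] by simp

lemma sublinear_tilt:
  assumes p: "sublinear p"
  shows "sublinear (tilt p y)"
  unfolding sublinear_def
proof (intro conjI allI impI)
  fix x z
  have "tilt p y (x + z) - (p (z + u *\<^sub>R y) - u * p y) \<le> p (x + t *\<^sub>R y) - t * p y"
    if "t \<ge> 0" "u \<ge> 0" for t u
  proof -
    have "x + z + (t + u) *\<^sub>R y = (x + t *\<^sub>R y) + (z + u *\<^sub>R y)" by (simp add: algebra_simps)
    then show ?thesis
      using tilt_le[OF p, of "t + u" y "x + z"] sublinear_add[OF p, of "x + t *\<^sub>R y" "z + u *\<^sub>R y"] that
      by (simp add: algebra_simps)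
  qed
  then have "tilt p y (x + z) - (p (z + u *\<^sub>R y) - u * p y) \<le> tilt p y x" if "u \<ge> 0" for u
    unfolding tilt_def[of p y x] using that by (intro cINF_greatest) auto
  then have "tilt p y (x + z) - tilt p y x \<le> p (z + u *\<^sub>R y) - u * p y" if "u \<ge> 0" for u
    using that by (smt (verit))
  then have "tilt p y (x + z) - tilt p y x \<le> tilt p y z"
    unfolding tilt_def[of p y z] by (intro cINF_greatest) auto
  then show "tilt p y (x + z) \<le> tilt p y x + tilt p y z" by simp
next
  have pos: "c * tilt p y x \<le> tilt p y (c *\<^sub>R x)" if c: "c > 0" for c x
    unfolding tilt_def[of p y "c *\<^sub>R x"]
  proof (rule cINF_greatest)
    fix t :: real assume "t \<in> {0..}"
    then have "tilt p y x \<le> p (x + (t / c) *\<^sub>R y) - t / c * p y"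
      using c by (intro tilt_le[OF p]) simp
    then have "c * tilt p y x \<le> c * (p (x + (t / c) *\<^sub>R y) - t / c * p y)"
      using c by simp
    also have "\<dots> = p (c *\<^sub>R (x + (t / c) *\<^sub>R y)) - t * p y"
      using c sublinear_scaleR[OF p, of c] by (simp add: right_diff_distrib)
    also have "c *\<^sub>R (x + (t / c) *\<^sub>R y) = c *\<^sub>R x + t *\<^sub>R y"
      using c by (simp add: scaleR_add_right)
    finally show "c * tilt p y x \<le> p (c *\<^sub>R x + t *\<^sub>R y) - t * p y" .
  qed auto
  fix c :: real and x assume "c \<ge> 0"
  show "tilt p y (c *\<^sub>R x) = c * tilt p y x"
  proof (cases "c = 0")
    case True
    have "tilt p y 0 = 0"
    proof (rule antisym)
      show "tilt p y 0 \<le> 0" using tilt_le_self[OF p, of y 0] sublinear_zero[OF p] by simp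
      show "0 \<le> tilt p y 0" unfolding tilt_def
        by (rule cINF_greatest) (auto simp: sublinear_scaleR[OF p])
    qed
    with True show ?thesis by simp
  next
    case False
    with \<open>c \<ge> 0\<close> have c: "c > 0" by simp
    have "inverse c * tilt p y (c *\<^sub>R x) \<le> tilt p y x"
      using pos[of "inverse c" "c *\<^sub>R x"] c by simp
    then have "tilt p y (c *\<^sub>R x) \<le> c * tilt p y x"
      using c by (simp add: field_simps)
    with pos[OF c, of x] show ?thesis by simp
  qed
qed

text \<open>
  By minimality \<open>p\<close> equals its tilt along \<open>y\<close>, and the value of the latter at \<open>x\<close> is at most
  \<open>p (x + y) - p y\<close>; so subadditivity is an equality.
\<close>

lemma linear_if_minimal_sublinear:
  assumes p: "sublinear p" and min: "\<And>q. sublinear q \<Longrightarrow> q \<le> p \<Longrightarrow> q = p"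
  shows "linear p"
proof -
  have "tilt p y = p" for y
    using p by (intro min sublinear_tilt le_funI tilt_le_self)
  then have "p x + p y \<le> p (x + y)" for x y
    using tilt_le[OF p, of 1 y x] by simp
  then have add: "p (x + y) = p x + p y" for x y
    using sublinear_add[OF p, of x y] by (simp add: antisym)
  then have neg: "p (- x) = - p x" for x
    using sublinear_zero[OF p] by (metis add.right_inverse add_eq_0_iff)
  show ?thesis
  proof (rule linearI)
    show "p (c *\<^sub>R x) = c *\<^sub>R p x" for c x
    proof (cases "c \<ge> 0")
      case False
      then show ?thesis
        using sublinear_scaleR[OF p, of "- c" x] neg[of "c *\<^sub>R x"] by simp
    qed (simp add: sublinear_scaleR[OF p])
  qed (rule add)
qed

text \<open>
  The Hahn--Banach theorem without subspaces: Zorn's lemma gives a minimal sublinear functional below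
  \<open>p0\<close>. The pointwise infimum of a chain is finite because \<open>p x \<ge> - p (- x) \<ge> - p0 (- x)\<close>, and it is
  subadditive because of any two members of the chain one lies below the other.
\<close>

lemma exists_linear_below_sublinear:
  assumes p0: "sublinear p0"
  obtains l where "linear l" "l \<le> p0"
proof -
  let ?S = "{p. sublinear p \<and> p \<le> p0}"
  have lower: "- p0 (- x) \<le> p x" if "p \<in> ?S" for p x
  proof -
    have "p (- x) \<le> p0 (- x)" using that by (auto simp: le_fun_def)
    then show ?thesis using sublinear_neg[of p x] that by simp
  qed
  have "\<exists>l\<in>?S. \<forall>q\<in>?S. l \<ge> q \<longrightarrow> q = l"
  proof (rule predicate_Zorn[where P = "(\<ge>)"])
    show "partial_order_on ?S (relation_of (\<ge>) ?S)"
      by (auto simp: partial_order_on_def preorder_on_def refl_on_def trans_def antisym_def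
          relation_of_def)
  next
    fix C assume C: "C \<in> Chains (relation_of (\<ge>) ?S)"
    then have CS: "C \<subseteq> ?S" and chain: "\<And>p q. p \<in> C \<Longrightarrow> q \<in> C \<Longrightarrow> p \<le> q \<or> q \<le> p"
      by (auto simp: Chains_def relation_of_def)
    show "\<exists>u\<in>?S. \<forall>p\<in>C. p \<ge> u"
    proof (cases "C = {}")
      case True
      with p0 show ?thesis by auto
    next
      case False
      define u where "u x = (INF p\<in>C. p x)" for x
      have le: "u x \<le> p x" if "p \<in> C" for p x
        unfolding u_def using that CS lower by (intro cINF_lower bdd_belowI2[where m = "- p0 (- x)"]) auto
      have gt: "c \<le> u x" if "\<And>p. p \<in> C \<Longrightarrow> c \<le> p x" for c x
        unfolding u_def using that False by (intro cINF_greatest) auto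
      have sub: "sublinear p" if "p \<in> C" for p using CS that by auto
      have "sublinear u"
        unfolding sublinear_def
      proof (intro conjI allI impI)
        fix x y
        have "u (x + y) \<le> p x + q y" if pq: "p \<in> C" "q \<in> C" for p q
        proof -
          define r where "r = (if p \<le> q then p else q)"
          have r: "r \<in> C" "r \<le> p" "r \<le> q"
            using chain[OF pq] pq by (auto simp: r_def)
          have "u (x + y) \<le> r x + r y"
            by (rule order_trans[OF le[OF r(1)] sublinear_add[OF sub[OF r(1)]]])
          also have "\<dots> \<le> p x + q y" by (intro add_mono le_funD[OF r(2)] le_funD[OF r(3)])
          finally show ?thesis .
        qed
        then have "u (x + y) - q y \<le> u x" if "q \<in> C" for q
          using that by (intro gt) (simp add: diff_le_eq)
        then have "u (x + y) - u x \<le> u y"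
          by (intro gt) (simp add: algebra_simps)
        then show "u (x + y) \<le> u x + u y" by simp
      next
        fix c :: real and x assume "c \<ge> 0"
        have "u (c *\<^sub>R x) = (INF p\<in>C. c * p x)"
          unfolding u_def using sub sublinear_scaleR \<open>c \<ge> 0\<close> by (intro INF_cong) auto
        also have "\<dots> = c * u x"
        proof (cases "c = 0")
          case True
          then show ?thesis using False by simp
        next
          case c: False
          show ?thesis
          proof (rule antisym)
            have "(INF p\<in>C. c * p x) / c \<le> u x"
            proof (rule gt)
              fix p assume "p \<in> C"
              have "bdd_below ((\<lambda>p. c * p x) ` C)"
                using le \<open>c \<ge> 0\<close> by (intro bdd_belowI2[where m = "c * u x"] mult_left_mono) auto
              then have "(INF p\<in>C. c * p x) \<le> c * p x"
                using \<open>p \<in> C\<close> by (rule cINF_lower)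
              then show "(INF p\<in>C. c * p x) / c \<le> p x"
                using c \<open>c \<ge> 0\<close> by (simp add: field_simps)
            qed
            then show "(INF p\<in>C. c * p x) \<le> c * u x"
              using c \<open>c \<ge> 0\<close> by (simp add: field_simps)
            show "c * u x \<le> (INF p\<in>C. c * p x)"
              using False le \<open>c \<ge> 0\<close> by (intro cINF_greatest mult_left_mono) auto
          qed
        qed
        finally show "u (c *\<^sub>R x) = c * u x" .
      qed
      moreover have "u \<le> p0"
      proof -
        obtain p where p: "p \<in> C" using False by blast
        then have "u \<le> p" by (intro le_funI le)
        also have "p \<le> p0" using p CS by blast
        finally show ?thesis .
      qed
      ultimately show ?thesis using le by (auto simp: le_fun_def)
    qed
  qed
  then obtain l where l: "sublinear l" "l \<le> p0"
    and min: "\<And>q. sublinear q \<Longrightarrow> q \<le> p0 \<Longrightarrow> q \<le> l \<Longrightarrow> q = l" by auto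
  have "linear l"
    using l by (intro linear_if_minimal_sublinear min) (auto intro: order_trans)
  with l that show thesis by blast
qed

lemma exists_norming_functional:
  fixes y :: "'a::real_normed_vector"
  obtains \<phi> :: "'a \<Rightarrow>\<^sub>L real" where "norm \<phi> \<le> 1" "blinfun_apply \<phi> y = norm y"
proof -
  have norm: "sublinear (norm :: 'a \<Rightarrow> real)"
    by (simp add: sublinear_def norm_triangle_ineq)
  obtain l where l: "linear l" "l \<le> tilt norm y"
    using exists_linear_below_sublinear[OF sublinear_tilt[OF norm]] .
  have le: "l x \<le> norm x" for x
    using l(2) tilt_le_self[OF norm, of y x] by (auto simp: le_fun_def intro: order_trans)
  have abs: "\<bar>l x\<bar> \<le> norm x" for x
    using le[of x] le[of "- x"] linear_neg[OF l(1), of x] by auto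
  have "l (- y) \<le> - norm y"
    using l(2) tilt_le[OF norm, of 1 y "- y"] by (auto simp: le_fun_def intro: order_trans)
  then have "l y = norm y"
    using le[of y] linear_neg[OF l(1), of y] by simp
  moreover have bl: "bounded_linear l"
    using l(1) abs by (intro bounded_linear_intro[where K = 1])
      (auto simp: linear_add linear_scale)
  moreover have "norm (Blinfun l) \<le> 1"
    using bl abs by (intro norm_blinfun_bound) (auto simp: bounded_linear_Blinfun_apply)
  ultimately show thesis
    using that[of "Blinfun l"] by (simp add: bounded_linear_Blinfun_apply)
qed

section \<open>Compactness and the canonical embedding\<close>

text \<open>
  Compactness in \<open>Y\<close> can therefore be tested in the bidual, where the averaged operators live.
\<close>

lemma norm_to_bidual [simp]: "norm (to_bidual y) = norm y"
proof (rule antisym)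
  show "norm (to_bidual y) \<le> norm y"
  proof (rule norm_blinfun_bound)
    show "norm (blinfun_apply (to_bidual y) \<phi>) \<le> norm y * norm \<phi>" for \<phi>
      using norm_blinfun[of \<phi> y] by (simp add: mult.commute)
  qed simp
  obtain \<phi> :: "'a \<Rightarrow>\<^sub>L real" where \<phi>: "norm \<phi> \<le> 1" "blinfun_apply \<phi> y = norm y"
    using exists_norming_functional[of y] .
  have "norm y \<le> norm (to_bidual y) * norm \<phi>"
    using norm_blinfun[of "to_bidual y" \<phi>] \<phi>(2) by simp
  also have "\<dots> \<le> norm (to_bidual y)"
    using \<phi>(1) by (simp add: mult_left_le)
  finally show "norm y \<le> norm (to_bidual y)" .
qed

lemma bounded_linear_to_bidual: "bounded_linear to_bidual"
  unfolding to_bidual_def [abs_def] by (rule blinfun.bounded_linear_prod_left)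

lemma compact_closure_subset:
  fixes C :: "'a::t2_space set"
  assumes "compact C" "X \<subseteq> C"
  shows "compact (closure X)"
proof -
  have "closure X \<subseteq> C" using assms by (intro closure_minimal compact_imp_closed)
  then show ?thesis
    using compact_Int_closed[OF assms(1) closed_closure, of X] by (simp add: Int_absorb1)
qed

text \<open>
  The embedding is an isometry with complete, hence closed, range, so the compact closure of the image
  of \<open>X\<close> stays in the range and can be pulled back.
\<close>

lemma compact_closure_if_compact_closure_to_bidual:
  fixes X :: "'y::banach set"
  assumes "compact (closure (to_bidual ` X))"
  shows "compact (closure X)"
proof -
  have "complete (range (to_bidual :: 'y \<Rightarrow> _))"
    by (rule complete_isometric_image[of 1])
      (auto simp: bounded_linear_to_bidual complete_UNIV)
  then have "closure (to_bidual ` X) \<subseteq> range to_bidual"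
    by (intro closure_minimal complete_imp_closed) auto
  moreover have inj: "inj (to_bidual :: 'y \<Rightarrow> _)"
    using linear_injective_0[OF bounded_linear.linear[OF bounded_linear_to_bidual]]
    by (metis norm_eq_zero norm_to_bidual)
  moreover have "dist (inv to_bidual u) (inv to_bidual v) = dist u v"
    if "u \<in> range to_bidual" "v \<in> range to_bidual" for u v :: "'y bidual"
    using that inj bounded_linear.linear[OF bounded_linear_to_bidual, where 'a = 'y]
    by (auto simp: dist_norm simp flip: linear_diff)
  ultimately have "continuous_on (closure (to_bidual ` X)) (inv to_bidual)"
    unfolding continuous_on_iff by (metis subsetD)
  then have C: "compact (inv to_bidual ` closure (to_bidual ` X))"
    using assms by (rule compact_continuous_image)
  have "X \<subseteq> inv to_bidual ` closure (to_bidual ` X)"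
    using inj closure_subset by (metis image_inv_f_f image_mono)
  with C show ?thesis by (intro compact_closure_subset)
qed

text \<open>
  Uniform approximation by compact sets, of arbitrary quality, gives total boundedness. This is how a
  norm limit of finite-rank operators is seen to be compact.
\<close>

lemma compact_closure_if_near_compact:
  fixes S :: "'a::complete_space set"
  assumes "\<And>e. e > 0 \<Longrightarrow> \<exists>C. compact C \<and> (\<forall>x\<in>S. \<exists>c\<in>C. dist x c < e)"
  shows "compact (closure S)"
  unfolding compact_eq_totally_bounded
proof (intro conjI allI impI)
  show "complete (closure S)" by (simp add: complete_eq_closed)
  fix e :: real assume "e > 0"
  then have e3: "e / 3 > 0" by simp
  obtain C where C: "compact C" "\<And>x. x \<in> S \<Longrightarrow> \<exists>c\<in>C. dist x c < e / 3"
    using assms[OF e3] by auto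
  obtain k where k: "finite k" "C \<subseteq> (\<Union>z\<in>k. ball z (e / 3))"
    using C(1) e3 compact_eq_totally_bounded[of C] by metis
  have "x \<in> (\<Union>z\<in>k. ball z e)" if x: "x \<in> closure S" for x
  proof -
    obtain y where y: "y \<in> S" "dist y x < e / 3"
      using x e3 closure_approachable[of x S] by metis
    obtain c where c: "c \<in> C" "dist y c < e / 3" using C(2)[OF y(1)] by blast
    obtain z where z: "z \<in> k" "dist z c < e / 3" using subsetD[OF k(2) c(1)] by (auto simp: mem_ball)
    have "dist z x < e"
      using y(2) c(2) z(2) dist_triangle[of z x c] dist_triangle[of c x y] dist_commute[of c y]
      by linarith
    then show ?thesis by (intro UN_I[OF z(1)]) simp
  qed
  with k(1) show "\<exists>k. finite k \<and> closure S \<subseteq> (\<Union>z\<in>k. ball z e)"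
    by (intro exI[of _ k] conjI subsetI)
qed

text \<open>
  Averaged operators map balls into such sets. They are compact, being images of cubes under linear maps;
  the induction adds one edge of the cube at a time.
\<close>

lemma compact_bounded_combinations:
  fixes v :: "'b \<Rightarrow> 'a::real_normed_vector"
  assumes "finite P"
  shows "compact {\<Sum>A\<in>P. c A *\<^sub>R v A | c. \<forall>A\<in>P. \<bar>c A\<bar> \<le> (K::real)}"
  using assms
proof (induction P)
  case (insert A P)
  let ?C = "\<lambda>P. {\<Sum>A\<in>P. c A *\<^sub>R v A | c. \<forall>A\<in>P. \<bar>c A\<bar> \<le> K}"
  have "?C (insert A P) = (\<lambda>(t, x). t *\<^sub>R v A + x) ` ({-K..K} \<times> ?C P)"
  proof (intro equalityI subsetI)
    fix x assume "x \<in> ?C (insert A P)"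
    then obtain c where "x = (\<Sum>A\<in>insert A P. c A *\<^sub>R v A)" "\<forall>A\<in>insert A P. \<bar>c A\<bar> \<le> K" by auto
    with insert.hyps show "x \<in> (\<lambda>(t, x). t *\<^sub>R v A + x) ` ({-K..K} \<times> ?C P)"
      by (intro image_eqI[of _ _ "(c A, \<Sum>A\<in>P. c A *\<^sub>R v A)"]) (auto simp: abs_le_iff minus_le_iff)
  next
    fix x assume "x \<in> (\<lambda>(t, x). t *\<^sub>R v A + x) ` ({-K..K} \<times> ?C P)"
    then obtain t c where tc: "x = t *\<^sub>R v A + (\<Sum>A\<in>P. c A *\<^sub>R v A)" "\<bar>t\<bar> \<le> K"
      "\<forall>A\<in>P. \<bar>c A\<bar> \<le> K" by fastforce
    have "(\<Sum>B\<in>P. (c(A := t)) B *\<^sub>R v B) = (\<Sum>B\<in>P. c B *\<^sub>R v B)"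
      using insert.hyps by (intro sum.cong) auto
    with tc insert.hyps show "x \<in> ?C (insert A P)"
      by (intro CollectI exI[of _ "c(A := t)"]) auto
  qed
  moreover have "compact \<dots>"
    using insert.IH unfolding case_prod_unfold
    by (intro compact_continuous_image continuous_intros compact_Times) auto
  ultimately show ?case by simp
qed simp

section \<open>Densities of signed Borel measures\<close>

lemma signed_borel_measure_empty:
  assumes "signed_borel_measure \<nu>"
  shows "\<nu> {} = 0"
proof -
  have "(\<lambda>i::nat. \<nu> {}) sums \<nu> {}"
    using assms[unfolded signed_borel_measure_def, rule_format, of "\<lambda>_. {}"]
    by (simp add: disjoint_family_on_def)
  then show ?thesis
    using sums_unique2 summable_const_iff[of "\<nu> {}"] sums_summable by blast
qed

lemma signed_borel_measure_Un:
  assumes \<nu>: "signed_borel_measure \<nu>" and "A \<in> sets borel" "B \<in> sets borel" "A \<inter> B = {}"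
  shows "\<nu> (A \<union> B) = \<nu> A + \<nu> B"
proof -
  have "(\<lambda>i. \<nu> (binaryset A B i)) sums \<nu> (\<Union>i. binaryset A B i)"
    using assms by (intro assms(1)[unfolded signed_borel_measure_def, rule_format])
      (auto simp: binaryset_def disjoint_family_on_def)
  moreover have "(\<lambda>i. \<nu> (binaryset A B i)) sums (\<nu> A + \<nu> B)"
    using binaryset_sums[of \<nu>] signed_borel_measure_empty[OF \<nu>] by blast
  ultimately show ?thesis
    using sums_unique2 by (fastforce simp: UN_binaryset_eq)
qed

text \<open>
  The positive variation of \<open>\<nu>\<close>, which is the positive term of its Jordan decomposition. The
  truncation of negative values by \<open>ennreal\<close> is harmless, because \<open>B = {}\<close> competes with value 0.
\<close>

definition positive_part :: "('h::topological_space set \<Rightarrow> real) \<Rightarrow> 'h set \<Rightarrow> ennreal" where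
  "positive_part \<nu> A = (SUP B\<in>{B\<in>sets borel. B \<subseteq> A}. ennreal (\<nu> B))"

lemma positive_part_upper: "B \<in> sets borel \<Longrightarrow> B \<subseteq> A \<Longrightarrow> ennreal (\<nu> B) \<le> positive_part \<nu> A"
  unfolding positive_part_def by (rule SUP_upper) simp

lemma positive_part_mono: "A \<subseteq> B \<Longrightarrow> positive_part \<nu> A \<le> positive_part \<nu> B"
  unfolding positive_part_def by (rule SUP_subset_mono) auto

lemma positive_part_Un:
  assumes \<nu>: "signed_borel_measure \<nu>" and A: "A \<in> sets borel" "B \<in> sets borel" "A \<inter> B = {}"
  shows "positive_part \<nu> A + positive_part \<nu> B \<le> positive_part \<nu> (A \<union> B)"
proof -
  have ne: "{C \<in> sets borel. C \<subseteq> X} \<noteq> {}" for X :: "'a set" by auto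
  have "ennreal (\<nu> C) + ennreal (\<nu> D) \<le> positive_part \<nu> (A \<union> B)"
    if "C \<in> sets borel" "C \<subseteq> A" "D \<in> sets borel" "D \<subseteq> B" for C D
  proof -
    have 1: "ennreal (\<nu> (C \<union> D)) \<le> positive_part \<nu> (A \<union> B)"
      using that by (intro positive_part_upper) auto
    have 2: "ennreal (\<nu> C) \<le> positive_part \<nu> (A \<union> B)" "ennreal (\<nu> D) \<le> positive_part \<nu> (A \<union> B)"
      using that by (auto intro!: positive_part_upper)
    have "\<nu> (C \<union> D) = \<nu> C + \<nu> D"
      using that A by (intro signed_borel_measure_Un[OF \<nu>]) auto
    with 1 2 show ?thesis
      by (cases "\<nu> C \<ge> 0"; cases "\<nu> D \<ge> 0") (auto simp: ennreal_plus ennreal_neg)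
  qed
  then have "ennreal (\<nu> C) + positive_part \<nu> B \<le> positive_part \<nu> (A \<union> B)"
    if "C \<in> sets borel" "C \<subseteq> A" for C
    unfolding positive_part_def[of \<nu> B] ennreal_SUP_add_right[OF ne]
    using that by (intro SUP_least) auto
  then show ?thesis
    unfolding positive_part_def[of \<nu> A] ennreal_SUP_add_left[OF ne, symmetric]
    by (intro SUP_least) auto
qed

text \<open>
  Superadditivity passes from two sets to finitely many and, by monotonicity, to sequences. Conversely,
  a subset of the union is cut into pieces, and the partial sums of their \<open>\<nu>\<close>-values are bounded by the
  series of the positive parts.
\<close>

lemma countably_additive_positive_part:
  assumes \<nu>: "signed_borel_measure \<nu>"
  shows "countably_additive (sets borel) (positive_part \<nu>)"
  unfolding countably_additive_def
proof (intro allI impI antisym)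
  fix A :: "nat \<Rightarrow> 'a set"
  assume A: "range A \<subseteq> sets borel" "disjoint_family A"
  have Ai: "A i \<in> sets borel" for i using A by auto
  show "(\<Sum>i. positive_part \<nu> (A i)) \<le> positive_part \<nu> (\<Union>i. A i)"
  proof (rule suminf_le_const)
    fix n
    have "(\<Sum>i<n. positive_part \<nu> (A i)) \<le> positive_part \<nu> (\<Union>i<n. A i)"
    proof (induction n)
      case (Suc n)
      have disj: "(\<Union>i<n. A i) \<inter> A n = {}"
      proof -
        have "A i \<inter> A n = {}" if "i < n" for i
          using A(2) that by (intro disjoint_family_onD) auto
        then show ?thesis by blast
      qed
      have "(\<Sum>i<Suc n. positive_part \<nu> (A i)) \<le> positive_part \<nu> (\<Union>i<n. A i) + positive_part \<nu> (A n)"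
        using Suc by (simp add: add_right_mono)
      also have "\<dots> \<le> positive_part \<nu> ((\<Union>i<n. A i) \<union> A n)"
        using Ai disj by (intro positive_part_Un[OF \<nu>]) auto
      also have "(\<Union>i<n. A i) \<union> A n = (\<Union>i<Suc n. A i)"
        by (auto simp: lessThan_Suc)
      finally show ?case .
    qed simp
    also have "\<dots> \<le> positive_part \<nu> (\<Union>i. A i)"
      by (rule positive_part_mono) auto
    finally show "(\<Sum>i<n. positive_part \<nu> (A i)) \<le> positive_part \<nu> (\<Union>i. A i)" .
  qed simp
  show "positive_part \<nu> (\<Union>i. A i) \<le> (\<Sum>i. positive_part \<nu> (A i))"
    unfolding positive_part_def[of \<nu> "\<Union>i. A i"]
  proof (rule SUP_least)
    fix B assume "B \<in> {B \<in> sets borel. B \<subseteq> (\<Union>i. A i)}"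
    then have B: "B \<in> sets borel" "B = (\<Union>i. A i \<inter> B)" by auto
    have "(\<lambda>i. \<nu> (A i \<inter> B)) sums \<nu> (\<Union>i. A i \<inter> B)"
      using A(2) B(1) Ai by (intro \<nu>[unfolded signed_borel_measure_def, rule_format])
        (auto simp: disjoint_family_on_def)
    then have sums: "(\<lambda>i. \<nu> (A i \<inter> B)) sums \<nu> B"
      unfolding B(2)[symmetric] .
    have "(\<Sum>i<n. ennreal (\<nu> (A i \<inter> B))) \<le> (\<Sum>i. positive_part \<nu> (A i))" for n
      using Ai B(1) by (intro order_trans[OF sum_mono sum_le_suminf] positive_part_upper) auto
    moreover have "ennreal (\<Sum>i<n. \<nu> (A i \<inter> B)) \<le> (\<Sum>i<n. ennreal (\<nu> (A i \<inter> B)))" for n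
    proof (induction n)
      case (Suc n)
      have "ennreal (a + b) \<le> ennreal a + ennreal b" for a b
        by (cases "a \<ge> 0"; cases "b \<ge> 0") (auto simp: ennreal_plus ennreal_neg ennreal_leI)
      from order_trans[OF this add_right_mono[OF Suc]] show ?case by simp
    qed simp
    ultimately have "ennreal (\<Sum>i<n. \<nu> (A i \<inter> B)) \<le> (\<Sum>i. positive_part \<nu> (A i))" for n
      by (rule order_trans[rotated])
    then show "ennreal (\<nu> B) \<le> (\<Sum>i. positive_part \<nu> (A i))"
      using sums unfolding sums_def
      by (intro LIMSEQ_le_const2[OF tendsto_ennrealI]) auto
  qed
qed

locale finite_borel_measure = finite_measure \<mu> for \<mu> :: "'h::topological_space measure" +
  assumes sets_eq_borel [measurable_cong]: "sets \<mu> = sets borel"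
begin

lemma space_eq_UNIV [simp]: "space \<mu> = UNIV"
  using sets_eq_imp_space_eq[OF sets_eq_borel] by simp

lemma set_integrable_borel:
  fixes f :: "'h \<Rightarrow> real"
  shows "integrable \<mu> f \<Longrightarrow> A \<in> sets borel \<Longrightarrow> set_integrable \<mu> A f"
  unfolding set_integrable_def by (rule integrable_mult_indicator) (simp add: sets_eq_borel)

text \<open>
  If \<open>\<nu>\<close> vanishes on \<open>\<mu>\<close>-null sets, then so does its positive part, because subsets of null sets
  are null; as it is a finite measure, the Radon--Nikodym theorem for positive measures applies.
\<close>

lemma positive_part_has_density:
  assumes \<nu>: "signed_borel_measure \<nu>" and bd: "\<And>A. A \<in> sets borel \<Longrightarrow> \<bar>\<nu> A\<bar> \<le> C"
    and ac: "\<And>A. A \<in> sets borel \<Longrightarrow> measure \<mu> A = 0 \<Longrightarrow> \<nu> A = 0"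
  obtains g where "integrable \<mu> g"
    "\<And>A. A \<in> sets borel \<Longrightarrow> positive_part \<nu> A = ennreal (LINT x:A|\<mu>. g x)"
    "\<And>A. A \<in> sets borel \<Longrightarrow> 0 \<le> (LINT x:A|\<mu>. g x)"
proof -
  define N where "N = measure_of UNIV (sets borel) (positive_part \<nu>)"
  have sets_N: "sets N = sets \<mu>"
    unfolding N_def by (simp add: sets_eq_borel sets.sigma_sets_eq[of borel, simplified])
  have "positive_part \<nu> {} = 0"
    by (simp add: positive_part_def signed_borel_measure_empty[OF \<nu>] cong: conj_cong)
  then have N: "emeasure N A = positive_part \<nu> A" if "A \<in> sets borel" for A
    using that countably_additive_positive_part[OF \<nu>]
    by (intro emeasure_measure_of[OF N_def])
      (auto simp: positive_def sets_N sets_eq_borel)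
  have "positive_part \<nu> UNIV \<le> ennreal C"
    unfolding positive_part_def using bd by (intro SUP_least ennreal_leI) (auto simp: abs_le_iff)
  then have fin: "finite_measure N"
    using N[of UNIV] by (intro finite_measureI) (auto simp: N_def top_unique)
  then interpret N: finite_measure N .
  have "absolutely_continuous \<mu> N"
    unfolding absolutely_continuous_def
  proof (intro subsetI)
    fix A assume "A \<in> null_sets \<mu>"
    then have A: "A \<in> sets borel" "emeasure \<mu> A = 0" by (auto simp: sets_eq_borel)
    have "\<nu> B = 0" if "B \<in> sets borel" "B \<subseteq> A" for B
    proof -
      have "emeasure \<mu> B = 0"
        using emeasure_mono[of B A \<mu>] that A by (simp add: sets_eq_borel)
      then show ?thesis using that by (intro ac) (auto simp: measure_def)
    qed
    then have "positive_part \<nu> A \<le> 0"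
      unfolding positive_part_def by (intro SUP_least) auto
    then show "A \<in> null_sets N"
      using A by (auto simp: N sets_N sets_eq_borel)
  qed
  then obtain D where D: "D \<in> borel_measurable \<mu>" "AE x in \<mu>. RN_deriv \<mu> N x = ennreal (D x)"
      "\<And>x. 0 \<le> D x" and ac: "absolutely_continuous \<mu> N"
    using real_RN_deriv[OF fin _ sets_N] by metis
  have "density \<mu> (\<lambda>x. ennreal (D x)) = density \<mu> (RN_deriv \<mu> N)"
    using D by (intro density_cong) auto
  then have dens: "N = density \<mu> (\<lambda>x. ennreal (D x))"
    using density_RN_deriv[OF ac sets_N] by simp
  have eq: "positive_part \<nu> A = \<integral>\<^sup>+x. ennreal (indicator A x * D x) \<partial>\<mu>" if "A \<in> sets borel" for A
  proof -
    have "positive_part \<nu> A = \<integral>\<^sup>+x. ennreal (D x) * indicator A x \<partial>\<mu>"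
      using that D(1) N[OF that] unfolding dens by (subst (asm) emeasure_density) (auto simp: sets_eq_borel)
    also have "\<dots> = \<integral>\<^sup>+x. ennreal (indicator A x * D x) \<partial>\<mu>"
      by (intro nn_integral_cong) (auto simp: indicator_def)
    finally show ?thesis .
  qed
  have int: "integrable \<mu> D"
  proof (rule integrableI_nonneg)
    show "(\<integral>\<^sup>+x. ennreal (D x) \<partial>\<mu>) < \<infinity>"
      using eq[of UNIV] \<open>positive_part \<nu> UNIV \<le> ennreal C\<close> by (auto simp: le_less_trans)
  qed (use D in auto)
  show thesis
  proof (rule that[OF int])
    fix A :: "'h set" assume A: "A \<in> sets borel"
    show "positive_part \<nu> A = ennreal (LINT x:A|\<mu>. D x)"
      unfolding eq[OF A] set_lebesgue_integral_def real_scaleR_def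
      using set_integrable_borel[OF int A] D(3)
      by (intro nn_integral_eq_integral) (auto simp: set_integrable_def)
    show "0 \<le> (LINT x:A|\<mu>. D x)"
      unfolding set_lebesgue_integral_def using D(3) by simp
  qed
qed

text \<open>
  The Radon--Nikodym theorem for a signed measure, by means of the Jordan decomposition: the positive
  parts of \<open>\<nu>\<close> and of \<open>- \<nu>\<close> have densities \<open>g\<close> and \<open>h\<close>, and \<open>\<nu>\<close> is their difference because
  \<open>\<nu> B = \<nu> A - \<nu> (A - B)\<close> turns a supremum of \<open>\<nu> B\<close> into one of \<open>- \<nu> (A - B)\<close>.
\<close>

lemma signed_borel_measure_has_density:
  assumes \<nu>: "signed_borel_measure \<nu>" and bd: "\<And>A. A \<in> sets borel \<Longrightarrow> \<bar>\<nu> A\<bar> \<le> C"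
    and ac: "\<And>A. A \<in> sets borel \<Longrightarrow> measure \<mu> A = 0 \<Longrightarrow> \<nu> A = 0"
  obtains g where "integrable \<mu> g" "\<And>A. A \<in> sets borel \<Longrightarrow> \<nu> A = (LINT x:A|\<mu>. g x)"
proof -
  have neg: "signed_borel_measure (\<lambda>A. - \<nu> A)"
    using \<nu> by (auto simp: signed_borel_measure_def intro: sums_minus)
  obtain g where g: "integrable \<mu> g"
    "\<And>A. A \<in> sets borel \<Longrightarrow> positive_part \<nu> A = ennreal (LINT x:A|\<mu>. g x)"
    "\<And>A. A \<in> sets borel \<Longrightarrow> 0 \<le> (LINT x:A|\<mu>. g x)"
    using positive_part_has_density[OF \<nu> bd ac] by blast
  obtain h where h: "integrable \<mu> h"
    "\<And>A. A \<in> sets borel \<Longrightarrow> positive_part (\<lambda>A. - \<nu> A) A = ennreal (LINT x:A|\<mu>. h x)"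
    "\<And>A. A \<in> sets borel \<Longrightarrow> 0 \<le> (LINT x:A|\<mu>. h x)"
    using positive_part_has_density[OF neg, of C] bd ac by auto
  have split: "\<nu> A = \<nu> B + \<nu> (A - B)" if "A \<in> sets borel" "B \<in> sets borel" "B \<subseteq> A" for A B
    using signed_borel_measure_Un[OF \<nu>, of B "A - B"] that by (simp add: Un_absorb1)
  \<comment> \<open>One half of the Jordan identity; used for \<open>\<nu>\<close> and for \<open>- \<nu>\<close>.\<close>
  have le: "(LINT x:A|\<mu>. k x) \<le> (LINT x:A|\<mu>. l x) + \<kappa> A"
    if A: "A \<in> sets borel"
      and k: "positive_part \<kappa> A = ennreal (LINT x:A|\<mu>. k x)"
      and l: "positive_part (\<lambda>A. - \<kappa> A) A = ennreal (LINT x:A|\<mu>. l x)"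
      and nonneg: "0 \<le> (LINT x:A|\<mu>. k x)" "0 \<le> (LINT x:A|\<mu>. l x)"
      and split: "\<And>B. B \<in> sets borel \<Longrightarrow> B \<subseteq> A \<Longrightarrow> \<kappa> A = \<kappa> B + \<kappa> (A - B)" for A k l \<kappa>
  proof -
    have upper: "\<kappa> B \<le> (LINT x:A|\<mu>. l x) + \<kappa> A" if "B \<in> sets borel" "B \<subseteq> A" for B
    proof -
      have "ennreal (- \<kappa> (A - B)) \<le> ennreal (LINT x:A|\<mu>. l x)"
        unfolding l[symmetric] using that A
        by (intro positive_part_upper[where \<nu> = "\<lambda>A. - \<kappa> A"]) auto
      then show ?thesis
        using split[OF that] nonneg(2) by (simp only: ennreal_le_iff)
    qed
    have "positive_part \<kappa> A \<le> ennreal ((LINT x:A|\<mu>. l x) + \<kappa> A)"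
      unfolding positive_part_def using upper by (intro SUP_least ennreal_leI) auto
    moreover have "0 \<le> (LINT x:A|\<mu>. l x) + \<kappa> A"
      using upper[OF sets.empty_sets empty_subsetI] split[OF sets.empty_sets empty_subsetI]
      unfolding Diff_empty by linarith
    ultimately show ?thesis unfolding k by (simp add: ennreal_le_iff)
  qed
  show thesis
  proof (rule that)
    show "integrable \<mu> (\<lambda>x. g x - h x)" using g h by simp
    fix A :: "'h set" assume A: "A \<in> sets borel"
    have "(LINT x:A|\<mu>. g x) \<le> (LINT x:A|\<mu>. h x) + \<nu> A"
      by (rule le[OF A g(2)[OF A] h(2)[OF A] g(3)[OF A] h(3)[OF A] split[OF A]])
    moreover have "(LINT x:A|\<mu>. h x) \<le> (LINT x:A|\<mu>. g x) + - \<nu> A"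
    proof (rule le[OF A h(2)[OF A] _ h(3)[OF A] g(3)[OF A]])
      show "positive_part (\<lambda>A. - (- \<nu> A)) A = ennreal (LINT x:A|\<mu>. g x)"
        using g(2)[OF A] by simp
      show "- \<nu> A = - \<nu> B + - \<nu> (A - B)" if "B \<in> sets borel" "B \<subseteq> A" for B
        using split[OF A that] by linarith
    qed
    moreover have "(LINT x:A|\<mu>. g x - h x) = (LINT x:A|\<mu>. g x) - (LINT x:A|\<mu>. h x)"
      using A g(1) h(1) by (intro set_integral_diff set_integrable_borel)
    ultimately show "\<nu> A = (LINT x:A|\<mu>. g x - h x)" by simp
  qed
qed

end

section \<open>Simple functions and semivariation\<close>

definition level_sets :: "('h \<Rightarrow> real) \<Rightarrow> 'h set set" where
  "level_sets s = (\<lambda>r. s -` {r}) ` range s"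

lemma simple_function_borel_vimage:
  fixes s :: "'h::topological_space \<Rightarrow> real"
  assumes "simple_function borel s"
  shows "s -` X \<in> sets borel" "finite (range s)"
  using simple_functionD[OF assms] by auto

lemma borel_partition_level_sets:
  fixes s :: "'h::topological_space \<Rightarrow> real"
  assumes "simple_function borel s"
  shows "borel_partition UNIV (level_sets s)"
  using simple_function_borel_vimage[OF assms]
  by (auto simp: borel_partition_def level_sets_def partition_on_def pairwise_def disjnt_def)

lemma simple_vector_integral_cong:
  assumes "simple_function borel s" "\<And>A. A \<in> sets borel \<Longrightarrow> k A = l A"
  shows "simple_vector_integral k s = simple_vector_integral l s"
  unfolding simple_vector_integral_def
  using simple_function_borel_vimage[OF assms(1)] assms(2) by (intro sum.cong) auto

lemma norm_le_semivariation:
  assumes "borel_partition A P" "\<And>B. B \<in> P \<Longrightarrow> \<bar>r B\<bar> \<le> 1"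
  shows "ennreal (norm (\<Sum>B\<in>P. r B *\<^sub>R m B)) \<le> semivariation m A"
  unfolding semivariation_def using assms by (intro SUP_upper2[where i = "(P, r)"]) auto

lemma norm_measure_le_semivariation:
  assumes "A \<in> sets borel" "k {} = 0"
  shows "ennreal (norm (k A)) \<le> semivariation k UNIV"
proof (cases "A = {}")
  case False
  have "borel_partition UNIV ({A, - A} - {{}})"
    using assms(1) by (auto simp: borel_partition_def partition_on_def pairwise_def disjnt_def)
  then have "ennreal (norm (\<Sum>B\<in>{A, - A} - {{}}. (if B = A then 1 else 0) *\<^sub>R k B))
      \<le> semivariation k UNIV"
    by (rule norm_le_semivariation) auto
  moreover have "(\<Sum>B\<in>{A, - A} - {{}}. (if B = A then 1 else 0) *\<^sub>R k B) = k A"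
    using False by (subst sum.mono_neutral_cong_right[where S = "{A}" and h = k]) auto
  ultimately show ?thesis by simp
qed (use assms in simp)

text \<open>
  The sum that defines the integral is \<open>c\<close> times one of the sums in the definition of the
  semivariation, namely that over the level sets of \<open>s\<close> with the values of \<open>s\<close> divided by \<open>c\<close>.
\<close>

lemma norm_simple_vector_integral_le:
  assumes s: "simple_function borel s" and c: "c > 0" "\<And>x. \<bar>s x\<bar> \<le> c"
    and e: "e \<ge> 0" "semivariation k UNIV \<le> ennreal e"
  shows "norm (simple_vector_integral k s) \<le> c * e"
proof -
  define r where "r B = the_elem (s ` B) / c" for B
  have r: "r (s -` {t}) = t / c" if "t \<in> range s" for t
  proof -
    have "s ` (s -` {t}) = {t}" using that by auto
    then show ?thesis by (simp add: r_def)
  qed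
  have "ennreal (norm (\<Sum>B\<in>level_sets s. r B *\<^sub>R k B)) \<le> ennreal e"
    using borel_partition_level_sets[OF s] c r
    by (intro order_trans[OF norm_le_semivariation e(2)]) (auto simp: level_sets_def)
  then have "norm (\<Sum>B\<in>level_sets s. r B *\<^sub>R k B) \<le> e"
    using e(1) by (simp add: ennreal_le_iff)
  moreover have "simple_vector_integral k s = c *\<^sub>R (\<Sum>B\<in>level_sets s. r B *\<^sub>R k B)"
  proof -
    have "inj_on (\<lambda>t. s -` {t}) (range s)" by (auto simp: inj_on_def)
    then have "(\<Sum>B\<in>level_sets s. r B *\<^sub>R k B) = (\<Sum>t\<in>range s. (t / c) *\<^sub>R k (s -` {t}))"
      unfolding level_sets_def by (subst sum.reindex) (auto intro!: sum.cong simp: r)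
    then show ?thesis
      using c by (simp add: simple_vector_integral_def scaleR_sum_right)
  qed
  ultimately show ?thesis using c by simp
qed

text \<open>
  The norm of the bidual is a supremum over the unit ball of \<open>Y\<^sup>*\<close>, so the semivariation is at most
  the supremum of the total variations of the scalar measures \<open>A \<mapsto> m A \<phi>\<close>.
\<close>

lemma semivariation_bidual_le:
  fixes k :: "'h::topological_space set \<Rightarrow> 'y::real_normed_vector bidual"
  assumes e: "e \<ge> 0"
    and le: "\<And>\<phi> P. norm \<phi> \<le> 1 \<Longrightarrow> borel_partition UNIV P \<Longrightarrow> (\<Sum>B\<in>P. \<bar>blinfun_apply (k B) \<phi>\<bar>) \<le> e"
  shows "semivariation k UNIV \<le> ennreal e"
  unfolding semivariation_def
proof (rule SUP_least, clarify, rule ennreal_leI)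
  fix P :: "'h set set" and r :: "'h set \<Rightarrow> real"
  assume P: "borel_partition UNIV P" and r: "\<forall>B\<in>P. \<bar>r B\<bar> \<le> 1"
  define v where "v = (\<Sum>B\<in>P. r B *\<^sub>R k B)"
  have unit: "\<bar>blinfun_apply v \<phi>\<bar> \<le> e" if "norm \<phi> \<le> 1" for \<phi>
  proof -
    have "\<bar>blinfun_apply v \<phi>\<bar> \<le> (\<Sum>B\<in>P. \<bar>r B * blinfun_apply (k B) \<phi>\<bar>)"
      unfolding v_def blinfun.sum_left blinfun.scaleR_left real_scaleR_def by (rule sum_abs)
    also have "\<dots> \<le> (\<Sum>B\<in>P. \<bar>blinfun_apply (k B) \<phi>\<bar>)"
      using r by (intro sum_mono) (auto simp: abs_mult mult_left_le_one_le)
    also have "\<dots> \<le> e" using le[OF that P] .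
    finally show ?thesis .
  qed
  have "norm v \<le> e"
  proof (rule norm_blinfun_bound[OF e])
    fix \<phi> :: "'y \<Rightarrow>\<^sub>L real"
    show "norm (blinfun_apply v \<phi>) \<le> e * norm \<phi>"
    proof (cases "\<phi> = 0")
      case False
      then show ?thesis
        using unit[of "\<phi> /\<^sub>R norm \<phi>"] by (simp add: blinfun.scaleR_right abs_mult field_simps)
    qed simp
  qed
  then show "norm (\<Sum>B\<in>P. r B *\<^sub>R k B) \<le> e" unfolding v_def .
qed

section \<open>Averaging over partitions\<close>

context finite_borel_measure
begin

lemma integrable_indicator_borel: "A \<in> sets borel \<Longrightarrow> integrable \<mu> (indicator A :: 'h \<Rightarrow> real)"
  by (rule integrable_real_indicator) (auto simp: sets_eq_borel less_top[symmetric])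

lemma set_lebesgue_integral_indicator:
  assumes "A \<in> sets borel" "B \<in> sets borel"
  shows "(LINT x:B|\<mu>. indicator A x) = measure \<mu> (A \<inter> B)"
proof -
  have "(LINT x:B|\<mu>. indicator A x :: real) = (\<integral>x. indicator (A \<inter> B) x \<partial>\<mu>)"
    unfolding set_lebesgue_integral_def
    by (intro Bochner_Integration.integral_cong) (auto simp: indicator_def)
  then show ?thesis by simp
qed

lemma sum_set_lebesgue_integral_partition:
  fixes g :: "'h \<Rightarrow> real"
  assumes P: "borel_partition UNIV P" and g: "integrable \<mu> g"
  shows "(\<Sum>B\<in>P. LINT x:B|\<mu>. g x) = (\<integral>x. g x \<partial>\<mu>)"
proof -
  have "(LINT x:(\<Union>B\<in>P. B)|\<mu>. g x) = (\<Sum>B\<in>P. LINT x:B|\<mu>. g x)"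
    using P g
    by (intro set_integral_finite_Union)
      (auto simp: borel_partition_def partition_on_def disjoint_family_on_def pairwise_def disjnt_def
        sets_eq_borel intro!: set_integrable_borel)
  moreover have "(\<Union>B\<in>P. B) = UNIV"
    using P by (auto simp: borel_partition_def partition_on_def)
  ultimately show ?thesis by (simp add: set_lebesgue_integral_def)
qed

lemma sum_measure_partition:
  assumes "borel_partition UNIV P" "A \<in> sets borel"
  shows "(\<Sum>B\<in>P. measure \<mu> (A \<inter> B)) = measure \<mu> A"
proof -
  have "(\<Sum>B\<in>P. measure \<mu> (A \<inter> B)) = (\<Sum>B\<in>P. LINT x:B|\<mu>. indicator A x)"
    using assms by (intro sum.cong) (auto simp: borel_partition_def set_lebesgue_integral_indicator)
  also have "\<dots> = (\<integral>x. indicator A x \<partial>\<mu>)"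
    using assms by (intro sum_set_lebesgue_integral_partition integrable_indicator_borel)
  finally show ?thesis by simp
qed

lemma abs_set_lebesgue_integral_le:
  fixes g :: "'h \<Rightarrow> real"
  assumes "integrable \<mu> g" "B \<in> sets borel"
  shows "\<bar>LINT x:B|\<mu>. g x\<bar> \<le> (LINT x:B|\<mu>. \<bar>g x\<bar>)"
  using set_integral_norm_bound[OF set_integrable_borel[OF assms]] by simp

lemma sum_abs_set_integral_le:
  fixes g :: "'h \<Rightarrow> real"
  assumes P: "borel_partition UNIV P" and g: "integrable \<mu> g"
  shows "(\<Sum>B\<in>P. \<bar>LINT x:B|\<mu>. g x\<bar>) \<le> (\<integral>x. \<bar>g x\<bar> \<partial>\<mu>)"
proof -
  have "(\<Sum>B\<in>P. \<bar>LINT x:B|\<mu>. g x\<bar>) \<le> (\<Sum>B\<in>P. LINT x:B|\<mu>. \<bar>g x\<bar>)"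
    using P g by (intro sum_mono abs_set_lebesgue_integral_le) (auto simp: borel_partition_def)
  also have "\<dots> = (\<integral>x. \<bar>g x\<bar> \<partial>\<mu>)"
    using g by (intro sum_set_lebesgue_integral_partition[OF P]) simp
  finally show ?thesis .
qed

text \<open>
  Split \<open>D\<close> according to the sign of \<open>g\<close>: smallness of a signed measure on all subsets of \<open>D\<close> controls
  its total variation on \<open>D\<close> up to the factor 2.
\<close>

lemma integral_abs_le_of_abs_set_integral_le:
  fixes g :: "'h \<Rightarrow> real"
  assumes g: "integrable \<mu> g" and D: "D \<in> sets borel"
    and le: "\<And>A. A \<in> sets borel \<Longrightarrow> A \<subseteq> D \<Longrightarrow> \<bar>LINT x:A|\<mu>. g x\<bar> \<le> e"
  shows "(LINT x:D|\<mu>. \<bar>g x\<bar>) \<le> 2 * e"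
proof -
  have [measurable]: "g \<in> borel_measurable borel"
    using borel_measurable_integrable[OF g] measurable_cong_sets[OF sets_eq_borel refl] by auto
  define A where "A = D \<inter> {x. g x \<ge> 0}"
  define B where "B = D \<inter> {x. g x < 0}"
  have [measurable]: "A \<in> sets borel" "B \<in> sets borel"
    using D unfolding A_def B_def by (auto intro!: sets.Int)
  have "(LINT x:D|\<mu>. \<bar>g x\<bar>) = (\<integral>x. indicator A x * g x - indicator B x * g x \<partial>\<mu>)"
    unfolding set_lebesgue_integral_def
    by (intro Bochner_Integration.integral_cong) (auto simp: A_def B_def indicator_def)
  also have "\<dots> = (LINT x:A|\<mu>. g x) - (LINT x:B|\<mu>. g x)"
    unfolding set_lebesgue_integral_def real_scaleR_def
    using set_integrable_borel[OF g, of A] set_integrable_borel[OF g, of B]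
    by (intro Bochner_Integration.integral_diff) (auto simp: set_integrable_def)
  also have "\<dots> \<le> 2 * e"
  proof -
    have "A \<subseteq> D" "B \<subseteq> D" by (auto simp: A_def B_def)
    then show ?thesis
      using le[OF \<open>A \<in> sets borel\<close>] le[OF \<open>B \<in> sets borel\<close>] by linarith
  qed
  finally show ?thesis .
qed

lemma simple_vector_integral_density:
  fixes g :: "'h \<Rightarrow> real"
  assumes s: "simple_function borel s" and g: "integrable \<mu> g"
  shows "simple_vector_integral (\<lambda>A. LINT x:A|\<mu>. g x) s = (\<integral>x. s x * g x \<partial>\<mu>)"
proof -
  have "simple_vector_integral (\<lambda>A. LINT x:A|\<mu>. g x) s
      = (\<Sum>r\<in>range s. \<integral>x. r * (indicator (s -` {r}) x * g x) \<partial>\<mu>)"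
    by (simp add: simple_vector_integral_def set_lebesgue_integral_def)
  also have "\<dots> = (\<integral>x. (\<Sum>r\<in>range s. r * (indicator (s -` {r}) x * g x)) \<partial>\<mu>)"
    using set_integrable_borel[OF g] simple_function_borel_vimage[OF s]
    by (intro Bochner_Integration.integral_sum[symmetric] integrable_mult_right)
      (auto simp: set_integrable_def)
  also have "\<dots> = (\<integral>x. s x * g x \<partial>\<mu>)"
  proof (intro Bochner_Integration.integral_cong refl)
    fix x
    have "(\<Sum>r\<in>range s. r * (indicator (s -` {r}) x * g x)) = (\<Sum>r\<in>range s. if r = s x then s x * g x else 0)"
      by (intro sum.cong) auto
    also have "\<dots> = s x * g x"
      using simple_function_borel_vimage(2)[OF s] by (simp add: sum.delta)
    finally show "(\<Sum>r\<in>range s. r * (indicator (s -` {r}) x * g x)) = s x * g x" .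
  qed
  finally show ?thesis .
qed

text \<open>
  Integrating against the averaged measure is the same as averaging the integrand; this links the
  averaged measures to the averaged operators.
\<close>

lemma simple_vector_integral_averaged:
  assumes s: "simple_function borel s" and Q: "borel_partition UNIV Q"
  shows "simple_vector_integral (averaged_measure \<mu> m Q) s
    = (\<Sum>A\<in>Q. ((LINT x:A|\<mu>. s x) / measure \<mu> A) *\<^sub>R m A)"
proof -
  have A: "(\<Sum>r\<in>range s. r * (measure \<mu> (A \<inter> s -` {r}) / measure \<mu> A)) = (LINT x:A|\<mu>. s x) / measure \<mu> A"
    if "A \<in> Q" for A
  proof -
    have A: "A \<in> sets borel" using Q that by (auto simp: borel_partition_def)
    have "(\<Sum>r\<in>range s. r * measure \<mu> (A \<inter> s -` {r}))
        = simple_vector_integral (\<lambda>B. LINT x:B|\<mu>. indicator A x) s"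
      unfolding simple_vector_integral_def
      using simple_function_borel_vimage(1)[OF s] A
      by (intro sum.cong) (auto simp: set_lebesgue_integral_indicator)
    also have "\<dots> = (LINT x:A|\<mu>. s x)"
      using A by (subst simple_vector_integral_density[OF s])
        (auto simp: integrable_indicator_borel set_lebesgue_integral_def mult.commute)
    finally show ?thesis by (simp flip: sum_divide_distrib)
  qed
  have "simple_vector_integral (averaged_measure \<mu> m Q) s
      = (\<Sum>r\<in>range s. \<Sum>A\<in>Q. (r * (measure \<mu> (A \<inter> s -` {r}) / measure \<mu> A)) *\<^sub>R m A)"
    by (simp add: simple_vector_integral_def averaged_measure_def scaleR_sum_right)
  also have "\<dots> = (\<Sum>A\<in>Q. (\<Sum>r\<in>range s. r * (measure \<mu> (A \<inter> s -` {r}) / measure \<mu> A)) *\<^sub>R m A)"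
    by (subst sum.swap) (simp add: scaleR_sum_left)
  also have "\<dots> = (\<Sum>A\<in>Q. ((LINT x:A|\<mu>. s x) / measure \<mu> A) *\<^sub>R m A)"
    by (intro sum.cong refl arg_cong2[where f = scaleR] A)
  finally show ?thesis .
qed

text \<open>
  The variation, over a test partition \<open>R\<close>, of the difference between \<open>g \<cdot> \<mu>\<close> and its average over
  \<open>Q\<close>. Its supremum over \<open>R\<close> is the \<open>L\<^sup>1\<close>-distance from \<open>g\<close> to its conditional expectation given
  \<open>Q\<close>.
\<close>

definition averaging_error :: "('h \<Rightarrow> real) \<Rightarrow> 'h set set \<Rightarrow> 'h set set \<Rightarrow> real" where
  "averaging_error g Q R =
     (\<Sum>B\<in>R. \<bar>averaged_measure \<mu> (\<lambda>A. LINT x:A|\<mu>. g x) Q B - (LINT x:B|\<mu>. g x)\<bar>)"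

text \<open>
  Averaging spreads the value \<open>\<nu> A\<close> over \<open>A\<close> with nonnegative weights of total mass at most 1, so
  it does not increase the variation.
\<close>

lemma sum_abs_averaged_measure_le:
  fixes \<nu> :: "'h set \<Rightarrow> real"
  assumes Q: "borel_partition UNIV Q" and R: "borel_partition UNIV R"
  shows "(\<Sum>B\<in>R. \<bar>averaged_measure \<mu> \<nu> Q B\<bar>) \<le> (\<Sum>A\<in>Q. \<bar>\<nu> A\<bar>)"
proof -
  have "(\<Sum>B\<in>R. \<bar>averaged_measure \<mu> \<nu> Q B\<bar>)
      \<le> (\<Sum>B\<in>R. \<Sum>A\<in>Q. measure \<mu> (A \<inter> B) / measure \<mu> A * \<bar>\<nu> A\<bar>)"
    unfolding averaged_measure_def
    by (intro sum_mono order_trans[OF sum_abs]) (auto simp: abs_mult)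
  also have "\<dots> = (\<Sum>A\<in>Q. (\<Sum>B\<in>R. measure \<mu> (A \<inter> B)) / measure \<mu> A * \<bar>\<nu> A\<bar>)"
    by (subst sum.swap) (simp add: sum_distrib_right sum_divide_distrib)
  also have "\<dots> \<le> (\<Sum>A\<in>Q. \<bar>\<nu> A\<bar>)"
  proof (rule sum_mono)
    fix A assume "A \<in> Q"
    then have "(\<Sum>B\<in>R. measure \<mu> (A \<inter> B)) = measure \<mu> A"
      using Q by (intro sum_measure_partition[OF R]) (auto simp: borel_partition_def)
    then show "(\<Sum>B\<in>R. measure \<mu> (A \<inter> B)) / measure \<mu> A * \<bar>\<nu> A\<bar> \<le> \<bar>\<nu> A\<bar>"
      by (cases "measure \<mu> A = 0") auto
  qed
  finally show ?thesis .
qed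

text \<open>
  Averaging is a linear contraction in the variation norm; hence the error depends on the density in a
  2-Lipschitz way with respect to the \<open>L\<^sup>1\<close>-norm, uniformly in both partitions. This reduces
  convergence to densities from a dense set, and uniform convergence to finite nets.
\<close>

lemma averaging_error_le:
  fixes g h :: "'h \<Rightarrow> real"
  assumes Q: "borel_partition UNIV Q" and R: "borel_partition UNIV R"
    and g: "integrable \<mu> g" and h: "integrable \<mu> h"
  shows "averaging_error g Q R \<le> 2 * (\<integral>x. \<bar>g x - h x\<bar> \<partial>\<mu>) + averaging_error h Q R"
proof -
  define G H K where "G A = (LINT x:A|\<mu>. g x)" and "H A = (LINT x:A|\<mu>. h x)"
    and "K A = (LINT x:A|\<mu>. g x - h x)" for A
  have diff: "G A = K A + H A" if "A \<in> sets borel" for A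
    using set_integral_diff(2)[OF set_integrable_borel[OF g that] set_integrable_borel[OF h that]]
    by (simp add: G_def H_def K_def)
  have "averaged_measure \<mu> G Q B = averaged_measure \<mu> K Q B + averaged_measure \<mu> H Q B" for B
    unfolding averaged_measure_def sum.distrib[symmetric] scaleR_add_right[symmetric]
    using Q diff by (intro sum.cong) (auto simp: borel_partition_def)
  then have "averaging_error g Q R
      \<le> (\<Sum>B\<in>R. \<bar>averaged_measure \<mu> K Q B\<bar> + \<bar>K B\<bar> + \<bar>averaged_measure \<mu> H Q B - H B\<bar>)"
    unfolding averaging_error_def G_def[symmetric] using R diff
    by (intro sum_mono) (auto simp: borel_partition_def subset_iff)
  also have "\<dots> = (\<Sum>B\<in>R. \<bar>averaged_measure \<mu> K Q B\<bar>) + (\<Sum>B\<in>R. \<bar>K B\<bar>) + averaging_error h Q R"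
    by (simp add: sum.distrib averaging_error_def H_def [abs_def])
  also have "(\<Sum>B\<in>R. \<bar>averaged_measure \<mu> K Q B\<bar>) \<le> (\<Sum>A\<in>Q. \<bar>K A\<bar>)"
    by (rule sum_abs_averaged_measure_le[OF Q R])
  also have "(\<Sum>A\<in>P. \<bar>K A\<bar>) \<le> (\<integral>x. \<bar>g x - h x\<bar> \<partial>\<mu>)" if "borel_partition UNIV P" for P
    unfolding K_def using that g h by (intro sum_abs_set_integral_le) auto
  from this[OF Q] this[OF R] have "(\<Sum>A\<in>Q. \<bar>K A\<bar>) + (\<Sum>B\<in>R. \<bar>K B\<bar>) \<le> 2 * (\<integral>x. \<bar>g x - h x\<bar> \<partial>\<mu>)"
    by simp
  finally show ?thesis by simp
qed

text \<open>
  A density that is constant on each member of \<open>Q\<close> equals its conditional expectation given \<open>Q\<close>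
  almost everywhere. The members of measure zero contribute nothing on either side.
\<close>

lemma averaging_error_eq_0:
  fixes s :: "'h \<Rightarrow> real"
  assumes Q: "borel_partition UNIV Q" and R: "borel_partition UNIV R"
    and s: "integrable \<mu> s" and const: "\<And>A. A \<in> Q \<Longrightarrow> \<exists>c. \<forall>x\<in>A. s x = c"
  shows "averaging_error s Q R = 0"
proof -
  have "averaged_measure \<mu> (\<lambda>A. LINT x:A|\<mu>. s x) Q B = (LINT x:B|\<mu>. s x)" if B: "B \<in> sets borel" for B
  proof -
    have "(measure \<mu> (A \<inter> B) / measure \<mu> A) *\<^sub>R (LINT x:A|\<mu>. s x) = (LINT x:A|\<mu>. indicator B x * s x)"
      if AQ: "A \<in> Q" for A
    proof -
      have A: "A \<in> sets borel" using Q AQ by (auto simp: borel_partition_def)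
      obtain c where c: "\<And>x. x \<in> A \<Longrightarrow> s x = c" using const[OF AQ] by auto
      have "(LINT x:A|\<mu>. s x) = (\<integral>x. c * indicator A x \<partial>\<mu>)"
        unfolding set_lebesgue_integral_def
        by (intro Bochner_Integration.integral_cong) (auto simp: indicator_def c)
      then have 1: "(LINT x:A|\<mu>. s x) = c * measure \<mu> A" by simp
      have "(LINT x:A|\<mu>. indicator B x * s x) = (\<integral>x. c * indicator (A \<inter> B) x \<partial>\<mu>)"
        unfolding set_lebesgue_integral_def
        by (intro Bochner_Integration.integral_cong) (auto simp: indicator_def c)
      then have 2: "(LINT x:A|\<mu>. indicator B x * s x) = c * measure \<mu> (A \<inter> B)" by simp
      show ?thesis
      proof (cases "measure \<mu> A = 0")
        case True
        then have "measure \<mu> (A \<inter> B) = 0"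
          using finite_measure_mono[of "A \<inter> B" A] A by (simp add: sets_eq_borel measure_le_0_iff)
        with 1 2 show ?thesis by simp
      qed (simp add: 1 2)
    qed
    then have "averaged_measure \<mu> (\<lambda>A. LINT x:A|\<mu>. s x) Q B = (\<Sum>A\<in>Q. LINT x:A|\<mu>. indicator B x * s x)"
      unfolding averaged_measure_def by (intro sum.cong) auto
    also have "\<dots> = (\<integral>x. indicator B x * s x \<partial>\<mu>)"
      using set_integrable_borel[OF s B]
      by (intro sum_set_lebesgue_integral_partition[OF Q]) (simp add: set_integrable_def)
    finally show ?thesis by (simp add: set_lebesgue_integral_def)
  qed
  then show ?thesis
    using R unfolding averaging_error_def by (intro sum.neutral) (auto simp: borel_partition_def)
qed

text \<open>
  Approximate \<open>g\<close> in \<open>L\<^sup>1\<close> by a simple function \<open>s\<close>. On every refinement of the partition into the level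
  sets of \<open>s\<close> averaging is exact for \<open>s\<close>, so only twice the approximation error remains.
\<close>

lemma eventually_averaging_error_le:
  fixes g :: "'h \<Rightarrow> real"
  assumes g: "integrable \<mu> g" and e: "e > 0"
  shows "\<forall>\<^sub>F Q in partition_net. \<forall>R. borel_partition UNIV R \<longrightarrow> averaging_error g Q R \<le> e"
proof -
  obtain s where s: "\<And>i. Bochner_Integration.simple_bochner_integrable \<mu> (s i)"
    and lim: "(\<lambda>i. \<integral>\<^sup>+x. norm (g x - s i x) \<partial>\<mu>) \<longlonglongrightarrow> 0"
    using g unfolding integrable.simps has_bochner_integral.simps by auto
  have "\<forall>\<^sub>F i in sequentially. (\<integral>\<^sup>+x. norm (g x - s i x) \<partial>\<mu>) < ennreal (e / 2)"
    using order_tendstoD(2)[OF lim, of "ennreal (e / 2)"] e by simp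
  then obtain i where i: "(\<integral>\<^sup>+x. norm (g x - s i x) \<partial>\<mu>) < ennreal (e / 2)"
    by (auto simp: eventually_sequentially)
  have int: "integrable \<mu> (s i)"
    using has_bochner_integral_simple_bochner_integrable[OF s] by (rule integrable.intros)
  have "simple_function \<mu> (s i)" using s[of i] by (auto elim: Bochner_Integration.simple_bochner_integrable.cases)
  then have simple: "simple_function borel (s i)"
    by (simp add: simple_function_def sets_eq_borel)
  have close: "2 * (\<integral>x. \<bar>g x - s i x\<bar> \<partial>\<mu>) \<le> e"
    using i e int g nn_integral_eq_integral[of \<mu> "\<lambda>x. norm (g x - s i x)"]
    by (simp add: ennreal_less_iff)
  have "averaging_error g Q R \<le> e"
    if Q: "borel_partition UNIV Q" and ref: "refines UNIV Q (level_sets (s i))"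
      and R: "borel_partition UNIV R" for Q R
  proof -
    have "\<exists>c. \<forall>x\<in>A. s i x = c" if "A \<in> Q" for A
      using ref that unfolding refines_def level_sets_def by fastforce
    then have "averaging_error (s i) Q R = 0"
      by (rule averaging_error_eq_0[OF Q R int])
    with averaging_error_le[OF Q R g int] close show ?thesis by simp
  qed
  then show ?thesis
    unfolding eventually_partition_net using borel_partition_level_sets[OF simple] by blast
qed

end

section \<open>Averaging a measure with compact range\<close>

text \<open>
  The easy half of Schauder's duality: the functionals of the unit ball are equicontinuous, so on a compact
  set \<open>C\<close> they are, up to \<open>e\<close>, only finitely many. A finite net \<open>F\<close> of \<open>C\<close> and the values on \<open>F\<close>, rounded
  to a grid of mesh \<open>e / 4\<close>, classify them; one representative is chosen in each class.
\<close>

lemma finite_functional_net: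
  fixes C :: "('a::real_normed_vector \<Rightarrow>\<^sub>L real) set"
  assumes C: "compact C" and e: "e > 0"
  obtains \<Phi> where "finite \<Phi>" "\<Phi> \<subseteq> cball 0 1"
    "\<And>\<phi>. norm \<phi> \<le> 1 \<Longrightarrow> \<exists>\<psi>\<in>\<Phi>. \<forall>u\<in>C. \<bar>blinfun_apply u \<phi> - blinfun_apply u \<psi>\<bar> \<le> e"
proof -
  have e4: "e / 4 > 0" using e by simp
  obtain F where F: "finite F" "C \<subseteq> (\<Union>v\<in>F. ball v (e / 4))"
    using C e4 compact_eq_totally_bounded[of C] by metis
  define grid where "grid \<phi> = restrict (\<lambda>v. \<lfloor>blinfun_apply v \<phi> / (e / 4)\<rfloor>) F" for \<phi>
  have "grid ` cball 0 1 \<subseteq> (\<Pi>\<^sub>E v\<in>F. {\<lfloor>- norm v / (e / 4)\<rfloor>..\<lfloor>norm v / (e / 4)\<rfloor>})"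
  proof (clarsimp simp: grid_def simp del: floor_divide_of_int_eq)
    fix \<phi> :: 'a and v assume "norm \<phi> \<le> 1" "v \<in> F"
    then have "\<bar>blinfun_apply v \<phi>\<bar> \<le> norm v"
      using norm_blinfun[of v \<phi>] by (auto intro: order_trans simp: mult_left_le)
    then show "\<lfloor>- (norm v * 4 / e)\<rfloor> \<le> \<lfloor>blinfun_apply v \<phi> * 4 / e\<rfloor> \<and>
        \<lfloor>blinfun_apply v \<phi> * 4 / e\<rfloor> \<le> \<lfloor>norm v * 4 / e\<rfloor>"
      using e by (intro conjI floor_mono) (auto simp: field_simps)
  qed
  then have fin: "finite (grid ` cball 0 1)"
    by (rule finite_subset) (use F in \<open>auto intro: finite_PiE\<close>)
  define \<Phi> where "\<Phi> = inv_into (cball 0 1) grid ` grid ` cball 0 1"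
  show thesis
  proof (rule that)
    show "finite \<Phi>" using fin by (simp add: \<Phi>_def)
    show "\<Phi> \<subseteq> cball 0 1" unfolding \<Phi>_def by (auto intro: inv_into_into simp del: mem_cball)
    fix \<phi> :: 'a assume \<phi>: "norm \<phi> \<le> 1"
    define \<psi> where "\<psi> = inv_into (cball 0 1) grid (grid \<phi>)"
    have "grid \<phi> \<in> grid ` cball 0 1" using \<phi> by auto
    then have \<psi>: "\<psi> \<in> cball 0 1" "grid \<psi> = grid \<phi>" "\<psi> \<in> \<Phi>"
      unfolding \<psi>_def \<Phi>_def by (rule inv_into_into f_inv_into_f imageI; assumption)+
    have "\<bar>blinfun_apply u \<phi> - blinfun_apply u \<psi>\<bar> \<le> e" if uC: "u \<in> C" for u
    proof -
      obtain v where v: "v \<in> F" "norm (u - v) \<le> e / 4"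
        using subsetD[OF F(2) uC] by (auto simp: dist_norm norm_minus_commute)
      have near: "\<bar>blinfun_apply u \<xi> - blinfun_apply v \<xi>\<bar> \<le> e / 4" if "norm \<xi> \<le> 1" for \<xi>
      proof -
        have "\<bar>blinfun_apply u \<xi> - blinfun_apply v \<xi>\<bar> \<le> norm (u - v) * norm \<xi>"
          using norm_blinfun[of "u - v" \<xi>] by (simp add: blinfun.diff_left)
        also have "\<dots> \<le> e / 4 * 1"
          using v(2) that e by (intro mult_mono) auto
        finally show ?thesis by simp
      qed
      have "\<lfloor>blinfun_apply v \<phi> / (e / 4)\<rfloor> = \<lfloor>blinfun_apply v \<psi> / (e / 4)\<rfloor>"
        using fun_cong[OF \<psi>(2), of v] v(1) by (simp add: grid_def)
      then have "\<bar>blinfun_apply v \<phi> / (e / 4) - blinfun_apply v \<psi> / (e / 4)\<bar> \<le> 1"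
        by linarith
      then have "\<bar>blinfun_apply v \<phi> - blinfun_apply v \<psi>\<bar> \<le> e / 4"
        using e unfolding abs_le_iff by (simp add: field_simps)
      then show ?thesis
        using near[OF \<phi>] near[of \<psi>] \<psi>(1) e unfolding mem_cball_0 by linarith
    qed
    with \<psi>(3) show "\<exists>\<psi>\<in>\<Phi>. \<forall>u\<in>C. \<bar>blinfun_apply u \<phi> - blinfun_apply u \<psi>\<bar> \<le> e" by blast
  qed
qed

lemma additive_empty:
  fixes m :: "'h::topological_space set \<Rightarrow> 'v::real_normed_vector"
  assumes "Measure_Space.additive (sets borel) m"
  shows "m {} = 0"
  using assms[unfolded Measure_Space.additive_def, rule_format, of "{}" "{}"] by simp

context finite_borel_measure
begin

text \<open>
  Finite semivariation bounds each scalar measure \<open>A \<mapsto> m A \<phi>\<close>, and \<open>m \<lless> \<mu>\<close> makes it vanish on null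
  sets.
\<close>

lemma bidual_measure_has_density:
  fixes m :: "'h set \<Rightarrow> 'y::real_normed_vector bidual"
  assumes add: "Measure_Space.additive (sets borel) m" and wr: "weakly_regular m"
    and sv: "semivariation m UNIV < \<infinity>" and ac: "vm_abs_continuous m \<mu>"
  obtains g where "\<And>\<phi>. integrable \<mu> (g \<phi>)"
    "\<And>\<phi> A. A \<in> sets borel \<Longrightarrow> blinfun_apply (m A) \<phi> = (LINT x:A|\<mu>. g \<phi> x)"
proof -
  obtain C where C: "C \<ge> 0" "semivariation m UNIV = ennreal C"
    using sv by (cases "semivariation m UNIV") auto
  have "\<exists>g. integrable \<mu> g \<and> (\<forall>A\<in>sets borel. blinfun_apply (m A) \<phi> = (LINT x:A|\<mu>. g x))" for \<phi>
  proof -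
    have signed: "signed_borel_measure (\<lambda>A. blinfun_apply (m A) \<phi>)"
      using wr by (simp add: weakly_regular_def)
    have bd: "\<bar>blinfun_apply (m A) \<phi>\<bar> \<le> C * norm \<phi>" if "A \<in> sets borel" for A
    proof -
      have "norm (m A) \<le> C"
        using norm_measure_le_semivariation[where k = m, OF that additive_empty[OF add]] C
        by (simp add: ennreal_le_iff)
      then show ?thesis
        using norm_blinfun[of "m A" \<phi>] mult_right_mono[of "norm (m A)" C "norm \<phi>"] by simp
    qed
    have null: "blinfun_apply (m A) \<phi> = 0" if "A \<in> sets borel" "measure \<mu> A = 0" for A
    proof -
      have "norm (m A) < \<epsilon>" if "\<epsilon> > 0" for \<epsilon>
        using ac[unfolded vm_abs_continuous_def, rule_format, OF that] \<open>A \<in> sets borel\<close>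
          \<open>measure \<mu> A = 0\<close> by auto
      then have "m A = 0" by (metis less_irrefl zero_less_norm_iff)
      then show ?thesis by simp
    qed
    show ?thesis
      by (rule signed_borel_measure_has_density[OF signed bd null]) auto
  qed
  then show thesis using that by metis
qed

text \<open>
  For a single functional \<open>\<phi>\<close> the averages of \<open>A \<mapsto> m A \<phi>\<close> converge in variation. Compactness of the
  range makes this uniform on the unit ball: \<open>\<phi>\<close> is, uniformly on the range, close to one of finitely many
  \<open>\<psi>\<close>, hence the densities of \<open>\<phi>\<close> and \<open>\<psi>\<close> are close in \<open>L\<^sup>1\<close> and so are their averaging errors.
\<close>

lemma averaged_measure_tendsto_of_compact_range:
  fixes m :: "'h set \<Rightarrow> 'y::real_normed_vector bidual"
  assumes g: "\<And>\<phi>. integrable \<mu> (g \<phi>)"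
    and m: "\<And>\<phi> A. A \<in> sets borel \<Longrightarrow> blinfun_apply (m A) \<phi> = (LINT x:A|\<mu>. g \<phi> x)"
    and compact: "compact (closure (m ` sets borel))"
  shows "((\<lambda>P. semivariation (\<lambda>B. averaged_measure \<mu> m P B - m B) UNIV) \<longlongrightarrow> 0) partition_net"
proof (rule order_tendstoI)
  fix a :: ennreal assume "0 < a"
  then obtain e where e: "0 < e" "ennreal e < a"
    using dense[of 0 a] by (metis ennreal_cases ennreal_less_zero_iff less_imp_le order.strict_trans not_less_iff_gr_or_eq top_greatest leD)
  obtain \<Phi> where \<Phi>: "finite \<Phi>" "\<And>\<phi>. norm \<phi> \<le> 1 \<Longrightarrow>
      \<exists>\<psi>\<in>\<Phi>. \<forall>u\<in>closure (m ` sets borel). \<bar>blinfun_apply u \<phi> - blinfun_apply u \<psi>\<bar> \<le> e / 8"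
  proof (rule finite_functional_net[OF compact, of "e / 8"])
    show "0 < e / 8" using e(1) by simp
  qed blast
  have "\<forall>\<^sub>F Q in partition_net. \<forall>\<psi>\<in>\<Phi>. \<forall>R. borel_partition UNIV R \<longrightarrow> averaging_error (g \<psi>) Q R \<le> e / 2"
    using e(1) g by (intro eventually_ball_finite[OF \<Phi>(1)] ballI eventually_averaging_error_le) auto
  moreover have "\<forall>\<^sub>F Q :: 'h set set in partition_net. borel_partition UNIV Q"
    unfolding eventually_partition_net using borel_partition_trivial by blast
  ultimately show "\<forall>\<^sub>F Q in partition_net. semivariation (\<lambda>B. averaged_measure \<mu> m Q B - m B) UNIV < a"
  proof eventually_elim
    case (elim Q)
    have "semivariation (\<lambda>B. averaged_measure \<mu> m Q B - m B) UNIV \<le> ennreal e"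
    proof (rule semivariation_bidual_le)
      fix \<phi> :: "'y \<Rightarrow>\<^sub>L real" and R :: "'h set set"
      assume \<phi>: "norm \<phi> \<le> 1" and R: "borel_partition UNIV R"
      obtain \<psi> where \<psi>: "\<psi> \<in> \<Phi>"
        "\<And>u. u \<in> closure (m ` sets borel) \<Longrightarrow> \<bar>blinfun_apply u \<phi> - blinfun_apply u \<psi>\<bar> \<le> e / 8"
        using \<Phi>(2)[OF \<phi>] by blast
      \<comment> \<open>The tolerance \<open>e / 8\<close> on sets becomes \<open>e / 4\<close> in \<open>L\<^sup>1\<close> and \<open>e / 2\<close> in the averaging error.\<close>
      have "\<bar>LINT x:A|\<mu>. g \<phi> x - g \<psi> x\<bar> \<le> e / 8" if "A \<in> sets borel" for A
        using \<psi>(2)[OF subsetD[OF closure_subset imageI[OF that]]] that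
          set_integral_diff(2)[OF set_integrable_borel[OF g that] set_integrable_borel[OF g that]]
        by (simp add: m)
      then have "(LINT x:UNIV|\<mu>. \<bar>g \<phi> x - g \<psi> x\<bar>) \<le> 2 * (e / 8)"
        using g by (intro integral_abs_le_of_abs_set_integral_le) auto
      then have close: "(\<integral>x. \<bar>g \<phi> x - g \<psi> x\<bar> \<partial>\<mu>) \<le> e / 4"
        by (simp add: set_lebesgue_integral_def)
      have avg: "blinfun_apply (averaged_measure \<mu> m Q B) \<phi>
          = averaged_measure \<mu> (\<lambda>A. LINT x:A|\<mu>. g \<phi> x) Q B" for B
        unfolding averaged_measure_def blinfun.sum_left blinfun.scaleR_left
        using elim(2) by (intro sum.cong) (auto simp: borel_partition_def m)
      have "(\<Sum>B\<in>R. \<bar>blinfun_apply (averaged_measure \<mu> m Q B - m B) \<phi>\<bar>) = averaging_error (g \<phi>) Q R"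
        unfolding averaging_error_def blinfun.diff_left avg
        using R by (intro sum.cong) (auto simp: borel_partition_def m)
      also have "\<dots> \<le> e"
        using averaging_error_le[OF elim(2) R g[of \<phi>] g[of \<psi>]] close elim(1) \<psi>(1) R by fastforce
      finally show "(\<Sum>B\<in>R. \<bar>blinfun_apply (averaged_measure \<mu> m Q B - m B) \<phi>\<bar>) \<le> e" .
    qed (use e in simp)
    with e(2) show ?case by simp
  qed
qed simp

section \<open>Averaged operators\<close>

lemma borel_measurable_bcontfun: "apply_bcontfun f \<in> borel_measurable borel"
  for f :: "'h \<Rightarrow>\<^sub>C real"
  by (intro borel_measurable_continuous_onI) simp

lemma integrable_of_bounded:
  fixes f :: "'h \<Rightarrow> real"
  assumes "f \<in> borel_measurable borel" "\<And>x. \<bar>f x\<bar> \<le> c"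
  shows "integrable \<mu> f"
proof (rule integrable_const_bound)
  show "f \<in> borel_measurable \<mu>"
    using assms(1) measurable_cong_sets[OF sets_eq_borel refl] by auto
qed (use assms in auto)

lemma integral_tendsto_of_uniform_limit:
  fixes s :: "nat \<Rightarrow> 'h \<Rightarrow> real"
  assumes lim: "uniform_limit UNIV s f sequentially"
    and s: "\<And>n. simple_function borel (s n)" and f: "f \<in> borel_measurable borel" "\<And>x. \<bar>f x\<bar> \<le> c"
    and h: "integrable \<mu> h"
  shows "(\<lambda>n. \<integral>x. s n x * h x \<partial>\<mu>) \<longlonglongrightarrow> (\<integral>x. f x * h x \<partial>\<mu>)"
proof (rule tendstoI)
  have [measurable]: "h \<in> borel_measurable \<mu>" "f \<in> borel_measurable \<mu>" "s n \<in> borel_measurable \<mu>" for n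
    using h f(1) borel_measurable_simple_function[OF s] measurable_cong_sets[OF sets_eq_borel refl]
    by auto
  fix \<epsilon> :: real assume \<epsilon>: "\<epsilon> > 0"
  define I where "I = (\<integral>x. \<bar>h x\<bar> \<partial>\<mu>)"
  have I: "I \<ge> 0" by (simp add: I_def)
  define \<delta> where "\<delta> = \<epsilon> / (I + 1)"
  have \<delta>: "\<delta> > 0" using \<epsilon> I by (simp add: \<delta>_def)
  have "\<forall>\<^sub>F n in sequentially. \<forall>x. \<bar>s n x - f x\<bar> < \<delta>"
    using uniform_limitD[OF lim \<delta>] by (simp add: dist_real_def)
  then show "\<forall>\<^sub>F n in sequentially. dist (\<integral>x. s n x * h x \<partial>\<mu>) (\<integral>x. f x * h x \<partial>\<mu>) < \<epsilon>"
  proof eventually_elim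
    case (elim n)
    have fh: "integrable \<mu> (\<lambda>x. f x * h x)"
      by (rule Bochner_Integration.integrable_bound[of _ "\<lambda>x. c * h x"])
        (use h f(2) in \<open>auto simp: abs_mult intro!: AE_I2 mult_right_mono intro: order_trans[OF _ abs_ge_self]\<close>)
    have le: "\<bar>(s n x - f x) * h x\<bar> \<le> \<delta> * \<bar>h x\<bar>" for x
      unfolding abs_mult using elim[rule_format, of x] by (intro mult_right_mono) auto
    have dh: "integrable \<mu> (\<lambda>x. (s n x - f x) * h x)"
      by (rule Bochner_Integration.integrable_bound[of _ "\<lambda>x. \<delta> * h x"])
        (use h le \<delta> in \<open>auto simp: abs_mult intro!: AE_I2\<close>)
    \<comment> \<open>Only the difference \<open>s n - f\<close> has a bound in terms of \<open>\<delta>\<close>, so \<open>s n \<cdot> h\<close> is recovered from it.\<close>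
    have "integrable \<mu> (\<lambda>x. (s n x - f x) * h x + f x * h x)" using fh dh by simp
    then have sh: "integrable \<mu> (\<lambda>x. s n x * h x)" by (simp add: algebra_simps)
    have "dist (\<integral>x. s n x * h x \<partial>\<mu>) (\<integral>x. f x * h x \<partial>\<mu>) = \<bar>\<integral>x. (s n x - f x) * h x \<partial>\<mu>\<bar>"
      using sh fh by (simp add: dist_real_def left_diff_distrib)
    also have "\<dots> \<le> (\<integral>x. \<delta> * \<bar>h x\<bar> \<partial>\<mu>)"
      using dh h le by (intro order_trans[OF integral_abs_bound] integral_mono) auto
    also have "\<dots> = \<delta> * I" by (simp add: I_def)
    also have "\<dots> < \<epsilon>" using \<epsilon> I by (simp add: \<delta>_def field_simps)
    finally show ?case .
  qed
qed

text \<open>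
  Simple functions \<open>s n\<close> that converge uniformly to \<open>f\<close> serve both integrals: along them the integral against
  the difference of the averaged measure and \<open>m\<close> tends to \<open>T\<^sub>Q f - T f\<close>, and it is bounded by the sup norm
  of \<open>s n\<close> times the semivariation of that difference.
\<close>

lemma norm_averaged_operator_diff_le:
  fixes m :: "'h set \<Rightarrow> 'v::real_normed_vector"
  assumes Q: "borel_partition UNIV Q" and int: "has_vector_integral m (apply_bcontfun f) I"
    and e: "e \<ge> 0" "semivariation (\<lambda>B. averaged_measure \<mu> m Q B - m B) UNIV \<le> ennreal e"
  shows "norm (averaged_operator \<mu> m Q f - I) \<le> e * norm f"
proof -
  obtain s where s: "\<And>n. simple_function borel (s n)"
    and lim: "uniform_limit UNIV s (apply_bcontfun f) sequentially"
    and I: "(\<lambda>n. simple_vector_integral m (s n)) \<longlonglongrightarrow> I"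
    using int unfolding has_vector_integral_def by blast
  let ?d = "\<lambda>B. averaged_measure \<mu> m Q B - m B"
  have "(\<lambda>n. simple_vector_integral (averaged_measure \<mu> m Q) (s n)) \<longlonglongrightarrow> averaged_operator \<mu> m Q f"
    unfolding simple_vector_integral_averaged[OF s Q] averaged_operator_def divide_inverse
  proof (intro tendsto_sum tendsto_scaleR tendsto_mult tendsto_const)
    fix A assume "A \<in> Q"
    then have "A \<in> sets borel" using Q by (auto simp: borel_partition_def)
    then show "(\<lambda>n. LINT x:A|\<mu>. s n x) \<longlonglongrightarrow> (LINT x:A|\<mu>. apply_bcontfun f x)"
      using integral_tendsto_of_uniform_limit[OF lim s borel_measurable_bcontfun, of "norm f" "indicator A"]
        norm_bounded[of f, unfolded real_norm_def]
      by (simp add: set_lebesgue_integral_def mult.commute integrable_indicator_borel)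
  qed
  then have "(\<lambda>n. norm (simple_vector_integral ?d (s n))) \<longlonglongrightarrow> norm (averaged_operator \<mu> m Q f - I)"
    using I unfolding simple_vector_integral_def scaleR_diff_right sum_subtractf
    by (intro tendsto_norm tendsto_diff)
  \<comment> \<open>The functions \<open>s n\<close> may exceed \<open>norm f\<close> slightly.\<close>
  then have "norm (averaged_operator \<mu> m Q f - I) \<le> (norm f + \<delta>) * e" if \<delta>: "\<delta> > 0" for \<delta>
  proof (rule tendsto_upperbound)
    have "\<forall>\<^sub>F n in sequentially. \<forall>x. \<bar>s n x - apply_bcontfun f x\<bar> < \<delta>"
      using uniform_limitD[OF lim \<delta>] by (simp add: dist_real_def)
    then show "\<forall>\<^sub>F n in sequentially. norm (simple_vector_integral ?d (s n)) \<le> (norm f + \<delta>) * e"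
    proof eventually_elim
      case (elim n)
      have "\<bar>s n x\<bar> \<le> norm f + \<delta>" for x
        using elim[rule_format, of x] norm_bounded[of f x] by (simp add: abs_le_iff abs_less_iff)
      then show ?case
        using \<delta> by (intro norm_simple_vector_integral_le[OF s _ _ e]) (auto simp: add_nonneg_pos)
    qed
  qed simp
  moreover have "((\<lambda>\<delta>. (norm f + \<delta>) * e) \<longlongrightarrow> (norm f + 0) * e) (at_right 0)"
    by (intro tendsto_intros)
  ultimately have "norm (averaged_operator \<mu> m Q f - I) \<le> (norm f + 0) * e"
    by (intro tendsto_lowerbound[where F = "at_right 0"]) (auto intro: eventually_at_right_less[THEN eventually_mono])
  then show ?thesis by (simp add: mult.commute)
qed

lemma averaged_operator_tendsto_of_averaged_measure_tendsto:
  fixes m :: "'h set \<Rightarrow> 'y::real_normed_vector bidual" and T :: "('h \<Rightarrow>\<^sub>C real) \<Rightarrow>\<^sub>L 'y"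
  assumes int: "\<And>f. has_vector_integral m (apply_bcontfun f) (to_bidual (blinfun_apply T f))"
    and lim: "((\<lambda>P. semivariation (\<lambda>B. averaged_measure \<mu> m P B - m B) UNIV) \<longlongrightarrow> 0) partition_net"
  shows "((\<lambda>P. onorm (\<lambda>f. averaged_operator \<mu> m P f - to_bidual (blinfun_apply T f))) \<longlongrightarrow> 0) partition_net"
proof (rule tendstoI)
  fix \<epsilon> :: real assume \<epsilon>: "\<epsilon> > 0"
  have "\<forall>\<^sub>F Q in partition_net. semivariation (\<lambda>B. averaged_measure \<mu> m Q B - m B) UNIV < ennreal (\<epsilon> / 2)"
    using order_tendstoD(2)[OF lim, of "ennreal (\<epsilon> / 2)"] \<epsilon> by simp
  moreover have "\<forall>\<^sub>F Q :: 'h set set in partition_net. borel_partition UNIV Q"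
    unfolding eventually_partition_net using borel_partition_trivial by blast
  ultimately show "\<forall>\<^sub>F Q in partition_net.
      dist (onorm (\<lambda>f. averaged_operator \<mu> m Q f - to_bidual (blinfun_apply T f))) 0 < \<epsilon>"
  proof eventually_elim
    case (elim Q)
    let ?D = "\<lambda>f. averaged_operator \<mu> m Q f - to_bidual (blinfun_apply T f)"
    have "bounded_linear ?D"
      by (intro bounded_linear_sub bounded_linear_averaged_operator elim sets_eq_borel
          bounded_linear_compose[OF bounded_linear_to_bidual] blinfun.bounded_linear_right)
        (rule finite_measure_axioms)
    then have "onorm ?D \<ge> 0" by (rule onorm_pos_le)
    moreover have "onorm ?D \<le> \<epsilon> / 2"
      using \<epsilon> elim(1) by (intro onorm_bound norm_averaged_operator_diff_le[OF elim(2) int]) auto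
    ultimately show ?case using \<epsilon> by (simp add: dist_real_def)
  qed
qed

lemma averaged_operator_in_bounded_combinations:
  assumes Q: "borel_partition UNIV Q" and f: "norm f \<le> c"
  shows "averaged_operator \<mu> m Q f \<in> {\<Sum>A\<in>Q. t A *\<^sub>R m A | t. \<forall>A\<in>Q. \<bar>t A\<bar> \<le> c}"
proof (intro CollectI exI conjI ballI)
  show "averaged_operator \<mu> m Q f
      = (\<Sum>A\<in>Q. (set_lebesgue_integral \<mu> A (apply_bcontfun f) / measure \<mu> A) *\<^sub>R m A)"
    by (simp add: averaged_operator_def)
  fix A assume "A \<in> Q"
  then have A: "A \<in> sets borel" using Q by (auto simp: borel_partition_def)
  have fb: "\<bar>apply_bcontfun f x\<bar> \<le> c" for x
    using norm_bounded[of f x] f by simp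
  have f_int: "integrable \<mu> (apply_bcontfun f)"
    by (rule integrable_of_bounded[OF borel_measurable_bcontfun fb])
  have "\<bar>LINT x:A|\<mu>. apply_bcontfun f x\<bar> \<le> (LINT x:A|\<mu>. \<bar>apply_bcontfun f x\<bar>)"
    by (rule abs_set_lebesgue_integral_le[OF f_int A])
  also have "\<dots> \<le> (LINT x:A|\<mu>. c)"
    using fb f_int A by (intro set_integral_mono set_integrable_borel) auto
  also have "\<dots> = c * measure \<mu> A"
    using A by (simp add: set_lebesgue_integral_def mult.commute)
  finally show "\<bar>set_lebesgue_integral \<mu> A (apply_bcontfun f) / measure \<mu> A\<bar> \<le> c"
    using order_trans[OF norm_ge_zero f] by (cases "measure \<mu> A = 0")
      (auto simp: pos_divide_le_eq zero_less_measure_iff)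
qed

text \<open>
  Each averaged operator has finite rank, so \<open>T\<close>, seen as an operator into the bidual, is a norm limit of
  compact operators; the isometric embedding brings compactness back to \<open>Y\<close>.
\<close>

lemma compact_operator_of_averaged_operator_tendsto:
  fixes m :: "'h set \<Rightarrow> 'y::banach bidual" and T :: "('h \<Rightarrow>\<^sub>C real) \<Rightarrow>\<^sub>L 'y"
  assumes lim: "((\<lambda>P. onorm (\<lambda>f. averaged_operator \<mu> m P f - to_bidual (blinfun_apply T f))) \<longlongrightarrow> 0) partition_net"
  shows "compact_operator T"
  unfolding compact_operator_def
proof (intro allI impI, rule compact_closure_if_compact_closure_to_bidual,
    rule compact_closure_if_near_compact)
  fix S :: "('h \<Rightarrow>\<^sub>C real) set" and e :: real
  assume "bounded S" and e: "e > 0"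
  then obtain c where c: "c > 0" "\<And>f. f \<in> S \<Longrightarrow> norm f \<le> c" unfolding bounded_pos by auto
  have "\<forall>\<^sub>F Q in partition_net. onorm (\<lambda>f. averaged_operator \<mu> m Q f - to_bidual (blinfun_apply T f)) < e / c"
    using e c(1) by (intro order_tendstoD(2)[OF lim]) simp
  then obtain Q where Q: "borel_partition UNIV Q"
    "onorm (\<lambda>f. averaged_operator \<mu> m Q f - to_bidual (blinfun_apply T f)) < e / c"
    unfolding eventually_partition_net by (auto simp: borel_partition_def intro: refines_refl)
  let ?D = "\<lambda>f. averaged_operator \<mu> m Q f - to_bidual (blinfun_apply T f)"
  let ?C = "{\<Sum>A\<in>Q. t A *\<^sub>R m A | t. \<forall>A\<in>Q. \<bar>t A\<bar> \<le> c}"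
  have D: "bounded_linear ?D"
    by (intro bounded_linear_sub bounded_linear_averaged_operator Q sets_eq_borel
        bounded_linear_compose[OF bounded_linear_to_bidual] blinfun.bounded_linear_right)
      (rule finite_measure_axioms)
  have "\<exists>v\<in>?C. dist (to_bidual (blinfun_apply T f)) v < e" if "f \<in> S" for f
  proof
    show "averaged_operator \<mu> m Q f \<in> ?C"
      by (rule averaged_operator_in_bounded_combinations[OF Q(1) c(2)[OF that]])
    have "norm (?D f) \<le> onorm ?D * norm f" by (rule onorm[OF D])
    also have "\<dots> \<le> onorm ?D * c"
      using c(2)[OF that] by (intro mult_left_mono onorm_pos_le D)
    also have "\<dots> < e" using Q(2) c(1) by (simp add: field_simps)
    finally show "dist (to_bidual (blinfun_apply T f)) (averaged_operator \<mu> m Q f) < e"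
      by (simp add: dist_norm norm_minus_commute)
  qed
  then show "\<exists>C. compact C \<and> (\<forall>x\<in>to_bidual ` blinfun_apply T ` S. \<exists>v\<in>C. dist x v < e)"
    using Q(1) by (intro exI[of _ ?C] conjI compact_bounded_combinations) (auto simp: borel_partition_def)
qed

end

section \<open>The range of the measure of a compact operator\<close>

text \<open>
  A norm compact set is weak* compact, hence weak* closed in the bidual. The hypothesis says that \<open>z\<close> is
  in its weak* closure; the sets \<open>?C (\<phi>, n)\<close> are the traces on \<open>Y\<close> of subbasic weak* neighbourhoods of \<open>z\<close>.
\<close>

lemma bidual_in_compact_image:
  fixes K :: "'y::real_normed_vector set" and z :: "'y bidual"
  assumes K: "compact K"
    and near: "\<And>F e. finite F \<Longrightarrow> e > 0 \<Longrightarrow> \<exists>y\<in>K. \<forall>\<phi>\<in>F. \<bar>blinfun_apply \<phi> y - blinfun_apply z \<phi>\<bar> \<le> e"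
  shows "z \<in> to_bidual ` K"
proof -
  let ?C = "\<lambda>(\<phi>, n::nat). {y. \<bar>blinfun_apply \<phi> y - blinfun_apply z \<phi>\<bar> \<le> inverse (Suc n)}"
  have "K \<inter> (\<Inter>p\<in>UNIV. ?C p) \<noteq> {}"
  proof (rule compact_imp_fip_image[OF K])
    show "closed (?C p)" for p
      by (cases p) (auto intro!: closed_Collect_le continuous_intros)
    fix I :: "(('y \<Rightarrow>\<^sub>L real) \<times> nat) set" assume I: "finite I"
    define N where "N = Max (insert 0 (snd ` I))"
    have N: "n \<le> N" if "(\<phi>, n) \<in> I" for \<phi> n
      using I that unfolding N_def by (intro Max_ge) (auto intro: rev_image_eqI)
    obtain y where y: "y \<in> K" "\<And>\<phi>. \<phi> \<in> fst ` I \<Longrightarrow> \<bar>blinfun_apply \<phi> y - blinfun_apply z \<phi>\<bar> \<le> inverse (Suc N)"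
      using near[of "fst ` I" "inverse (Suc N)"] I by auto
    have "y \<in> ?C p" if "p \<in> I" for p
    proof (cases p)
      case (Pair \<phi> n)
      then have "\<bar>blinfun_apply \<phi> y - blinfun_apply z \<phi>\<bar> \<le> inverse (Suc N)"
        using that by (intro y(2)) (auto intro: rev_image_eqI)
      also have "\<dots> \<le> inverse (Suc n)"
        using N[of \<phi> n] that Pair by (intro le_imp_inverse_le) auto
      finally show ?thesis using Pair by simp
    qed
    with y(1) show "K \<inter> (\<Inter>p\<in>I. ?C p) \<noteq> {}" by blast
  qed
  then obtain y where y: "y \<in> K" "\<And>\<phi> n. \<bar>blinfun_apply \<phi> y - blinfun_apply z \<phi>\<bar> \<le> inverse (Suc n)"
    by fastforce
  have "blinfun_apply \<phi> y = blinfun_apply z \<phi>" for \<phi>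
  proof (rule ccontr)
    assume "blinfun_apply \<phi> y \<noteq> blinfun_apply z \<phi>"
    then obtain n where "inverse (Suc n) < \<bar>blinfun_apply \<phi> y - blinfun_apply z \<phi>\<bar>"
      using reals_Archimedean[of "\<bar>blinfun_apply \<phi> y - blinfun_apply z \<phi>\<bar>"] by auto
    with y(2)[of \<phi> n] show False by simp
  qed
  then have "z = to_bidual y" by (intro blinfun_eqI) simp
  with y(1) show ?thesis by blast
qed

lemma urysohn_bcontfun:
  fixes K U :: "'h::t2_space set"
  assumes compact: "compact (UNIV :: 'h set)" and K: "compact K" "open U" "K \<subseteq> U"
  obtains f :: "'h \<Rightarrow>\<^sub>C real" where "\<And>x. 0 \<le> apply_bcontfun f x" "\<And>x. apply_bcontfun f x \<le> 1"
    "\<And>x. x \<in> K \<Longrightarrow> apply_bcontfun f x = 1" "\<And>x. x \<notin> U \<Longrightarrow> apply_bcontfun f x = 0"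
proof -
  have "normal_space (euclidean :: 'h topology)"
    using compact by (intro compact_Hausdorff_or_regular_imp_normal_space)
      (simp_all add: compact_space_def Hausdorff_space_def disjnt_def, metis hausdorff)
  moreover have "closedin euclidean (- U)" "closedin euclidean K"
    using K compact_imp_closed by auto
  moreover have "disjnt (- U) K" using K(3) by (auto simp: disjnt_def)
  ultimately obtain f where f: "continuous_map euclidean (top_of_set {0..1::real}) f"
    "f ` (- U) \<subseteq> {0}" "f ` K \<subseteq> {1}"
    using Urysohn_lemma[of euclidean "- U" K 0 "1::real"] by auto
  have bounds: "0 \<le> f x" "f x \<le> 1" for x
    using f(1) by (auto simp: continuous_map_in_subtopology)
  have "f \<in> bcontfun"
    using f(1) bounds by (intro bcontfun_normI[where b = 1]) (auto simp: continuous_map_in_subtopology)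
  then have "apply_bcontfun (Bcontfun f) = f" by (rule Bcontfun_inverse)
  with f bounds show thesis by (intro that[of "Bcontfun f"]) auto
qed

context finite_borel_measure
begin

text \<open>
  With this formula, comparing \<open>\<phi> (T f)\<close> with \<open>m A \<phi>\<close> becomes an \<open>L\<^sup>1\<close>-estimate of \<open>f\<close> against the
  indicator of \<open>A\<close>.
\<close>

lemma has_vector_integral_density:
  fixes m :: "'h set \<Rightarrow> 'y::real_normed_vector bidual"
  assumes int: "has_vector_integral m (apply_bcontfun f) (to_bidual y)"
    and g: "integrable \<mu> g" and m: "\<And>A. A \<in> sets borel \<Longrightarrow> blinfun_apply (m A) \<phi> = (LINT x:A|\<mu>. g x)"
  shows "blinfun_apply \<phi> y = (\<integral>x. apply_bcontfun f x * g x \<partial>\<mu>)"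
proof -
  obtain s where s: "\<And>n. simple_function borel (s n)"
    and lim: "uniform_limit UNIV s (apply_bcontfun f) sequentially"
    and I: "(\<lambda>n. simple_vector_integral m (s n)) \<longlonglongrightarrow> to_bidual y"
    using int unfolding has_vector_integral_def by blast
  have eq: "blinfun_apply (simple_vector_integral m (s n)) \<phi> = (\<integral>x. s n x * g x \<partial>\<mu>)" for n
  proof -
    have "blinfun_apply (simple_vector_integral m (s n)) \<phi>
        = simple_vector_integral (\<lambda>A. blinfun_apply (m A) \<phi>) (s n)"
      by (simp add: simple_vector_integral_def blinfun.sum_left blinfun.scaleR_left)
    also have "\<dots> = simple_vector_integral (\<lambda>A. LINT x:A|\<mu>. g x) (s n)"
      by (rule simple_vector_integral_cong[OF s m])
    also have "\<dots> = (\<integral>x. s n x * g x \<partial>\<mu>)"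
      by (rule simple_vector_integral_density[OF s g])
    finally show ?thesis .
  qed
  have "(\<lambda>n. blinfun_apply (simple_vector_integral m (s n)) \<phi>) \<longlonglongrightarrow> blinfun_apply (to_bidual y) \<phi>"
    by (intro tendsto_intros I)
  moreover have "(\<lambda>n. \<integral>x. s n x * g x \<partial>\<mu>) \<longlonglongrightarrow> (\<integral>x. apply_bcontfun f x * g x \<partial>\<mu>)"
    using norm_bounded[of f, unfolded real_norm_def]
    by (intro integral_tendsto_of_uniform_limit[OF lim s borel_measurable_bcontfun _ g]) auto
  ultimately show ?thesis
    unfolding eq to_bidual_apply by (rule LIMSEQ_unique)
qed

end

text \<open>
  Every value \<open>m A\<close> is a weak* limit of values of \<open>T\<close> on the unit ball: for finitely many \<open>\<phi>\<close>, regularity of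
  the scalar measures gives a compact set inside \<open>A\<close> and an open set around it whose difference has small
  variation, and a Urysohn function between the two is close to the indicator of \<open>A\<close> in \<open>L\<^sup>1\<close> of each of
  these measures. Since \<open>T\<close> is compact, the limit lies in the compact set \<open>to_bidual ` K\<close>.
\<close>

lemma compact_range_of_compact_operator:
  fixes \<mu> :: "'h::t2_space measure" and m :: "'h set \<Rightarrow> 'y::real_normed_vector bidual"
    and T :: "('h \<Rightarrow>\<^sub>C real) \<Rightarrow>\<^sub>L 'y"
  assumes "finite_borel_measure \<mu>" and compact: "compact (UNIV :: 'h set)"
    and int: "\<And>f. has_vector_integral m (apply_bcontfun f) (to_bidual (blinfun_apply T f))"
    and wr: "weakly_regular m"
    and g: "\<And>\<phi>. integrable \<mu> (g \<phi>)"
    and m: "\<And>\<phi> A. A \<in> sets borel \<Longrightarrow> blinfun_apply (m A) \<phi> = (LINT x:A|\<mu>. g \<phi> x)"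
    and T: "compact_operator T"
  shows "compact (closure (m ` sets borel))"
proof -
  interpret finite_borel_measure \<mu> by fact
  define K where "K = closure (blinfun_apply T ` cball 0 1)"
  have K: "compact K" using T by (simp add: K_def compact_operator_def)
  have "m A \<in> to_bidual ` K" if A: "A \<in> sets borel" for A
  proof (rule bidual_in_compact_image[OF K])
    fix F :: "('y \<Rightarrow>\<^sub>L real) set" and e :: real
    assume F: "finite F" and e: "e > 0"
    have "\<forall>\<phi>. \<exists>C U. compact C \<and> open U \<and> C \<subseteq> A \<and> A \<subseteq> U \<and>
        (\<forall>B\<in>sets borel. B \<subseteq> U - C \<longrightarrow> \<bar>blinfun_apply (m B) \<phi>\<bar> < e / 2)"
    proof
      fix \<phi>
      have "regular_set_function (\<lambda>A. blinfun_apply (m A) \<phi>)"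
        using wr by (simp add: weakly_regular_def)
      then show "\<exists>C U. compact C \<and> open U \<and> C \<subseteq> A \<and> A \<subseteq> U \<and>
          (\<forall>B\<in>sets borel. B \<subseteq> U - C \<longrightarrow> \<bar>blinfun_apply (m B) \<phi>\<bar> < e / 2)"
        unfolding regular_set_function_def using A half_gt_zero[OF e] by blast
    qed
    then obtain C U where CU: "\<And>\<phi>. compact (C \<phi>)" "\<And>\<phi>. open (U \<phi>)" "\<And>\<phi>. C \<phi> \<subseteq> A" "\<And>\<phi>. A \<subseteq> U \<phi>"
      and small: "\<And>\<phi> B. B \<in> sets borel \<Longrightarrow> B \<subseteq> U \<phi> - C \<phi> \<Longrightarrow> \<bar>blinfun_apply (m B) \<phi>\<bar> < e / 2"
      by metis
    define C' U' where "C' = (\<Union>\<phi>\<in>F. C \<phi>)" and "U' = (\<Inter>\<phi>\<in>F. U \<phi>)"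
    have C'U': "compact C'" "open U'" "C' \<subseteq> A" "A \<subseteq> U'"
    proof -
      show "compact C'" unfolding C'_def using F CU(1) by (rule compact_UN)
      show "open U'" unfolding U'_def using F CU(2) by (intro open_INT) auto
      show "C' \<subseteq> A" unfolding C'_def by (intro UN_least CU(3))
      show "A \<subseteq> U'" unfolding U'_def by (intro INT_greatest CU(4))
    qed
    obtain f :: "'h \<Rightarrow>\<^sub>C real" where f: "\<And>x. 0 \<le> apply_bcontfun f x" "\<And>x. apply_bcontfun f x \<le> 1"
      "\<And>x. x \<in> C' \<Longrightarrow> apply_bcontfun f x = 1" "\<And>x. x \<notin> U' \<Longrightarrow> apply_bcontfun f x = 0"
      using urysohn_bcontfun[OF compact C'U'(1,2)] C'U'(3,4) by blast
    have "norm f \<le> 1"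
      using f(1,2) by (intro norm_bound) auto
    then have "blinfun_apply T f \<in> K"
      unfolding K_def by (intro subsetD[OF closure_subset]) auto
    moreover have "\<bar>blinfun_apply \<phi> (blinfun_apply T f) - blinfun_apply (m A) \<phi>\<bar> \<le> e" if "\<phi> \<in> F" for \<phi>
    proof -
      let ?D = "U' - C'"
      have D: "?D \<in> sets borel" using C'U'(1,2) by (intro sets.Diff borel_open borel_closed compact_imp_closed)
      have fg: "integrable \<mu> (\<lambda>x. apply_bcontfun f x * g \<phi> x)"
        using f(1,2) g[of \<phi>] borel_measurable_bcontfun[of f] measurable_cong_sets[OF sets_eq_borel refl]
        by (intro Bochner_Integration.integrable_bound[OF g[of \<phi>]])
          (auto simp: abs_mult intro!: AE_I2 mult_left_le_one_le borel_measurable_times)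
      have Ag: "integrable \<mu> (\<lambda>x. indicator A x * g \<phi> x)"
        using set_integrable_borel[OF g A] by (simp add: set_integrable_def)
      have "blinfun_apply \<phi> (blinfun_apply T f) - blinfun_apply (m A) \<phi>
          = (\<integral>x. apply_bcontfun f x * g \<phi> x - indicator A x * g \<phi> x \<partial>\<mu>)"
        using fg Ag A by (simp add: has_vector_integral_density[OF int g m] m set_lebesgue_integral_def)
      also have "\<bar>\<dots>\<bar> \<le> (\<integral>x. \<bar>apply_bcontfun f x * g \<phi> x - indicator A x * g \<phi> x\<bar> \<partial>\<mu>)"
        by (rule integral_abs_bound)
      also have "\<dots> \<le> (LINT x:?D|\<mu>. \<bar>g \<phi> x\<bar>)"
        unfolding set_lebesgue_integral_def
      proof (rule integral_mono)
        show "integrable \<mu> (\<lambda>x. indicator ?D x *\<^sub>R \<bar>g \<phi> x\<bar>)"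
          using set_integrable_borel[OF integrable_abs[OF g] D] by (simp add: set_integrable_def)
        fix x
        have "\<bar>apply_bcontfun f x - indicator A x\<bar> \<le> indicator ?D x"
          using f(1)[of x] f(2)[of x] f(3)[of x] f(4)[of x] C'U'(3,4) by (auto simp: indicator_def)
        then have "\<bar>apply_bcontfun f x - indicator A x\<bar> * \<bar>g \<phi> x\<bar> \<le> indicator ?D x * \<bar>g \<phi> x\<bar>"
          by (rule mult_right_mono) simp
        then show "\<bar>apply_bcontfun f x * g \<phi> x - indicator A x * g \<phi> x\<bar> \<le> indicator ?D x *\<^sub>R \<bar>g \<phi> x\<bar>"
          by (simp add: left_diff_distrib flip: abs_mult)
      qed (use fg Ag in simp)
      also have "\<dots> \<le> 2 * (e / 2)"
      proof (rule integral_abs_le_of_abs_set_integral_le[OF g D])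
        fix B :: "'h set" assume "B \<in> sets borel" "B \<subseteq> ?D"
        then show "\<bar>LINT x:B|\<mu>. g \<phi> x\<bar> \<le> e / 2"
          using small[of B \<phi>] \<open>\<phi> \<in> F\<close> by (fastforce simp: m C'_def U'_def)
      qed
      finally show ?thesis by simp
    qed
    ultimately show "\<exists>y\<in>K. \<forall>\<phi>\<in>F. \<bar>blinfun_apply \<phi> y - blinfun_apply (m A) \<phi>\<bar> \<le> e" by blast
  qed
  then have "m ` sets borel \<subseteq> to_bidual ` K" by blast
  moreover have "compact (to_bidual ` K)"
    using K by (intro compact_continuous_image linear_continuous_on bounded_linear_to_bidual)
  ultimately show ?thesis by (intro compact_closure_subset)
qed

section \<open>The equivalence\<close>

theorem theorem2:
  fixes T :: "('h::t2_space \<Rightarrow>\<^sub>C real) \<Rightarrow>\<^sub>L 'y::banach"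
    and m :: "'h set \<Rightarrow> 'y bidual"
    and \<mu> :: "'h measure"
  assumes "compact (UNIV :: 'h set)"
    and "representing_measure m T"
    and "sets \<mu> = sets borel"
    and "finite_measure \<mu>"
    and "vm_abs_continuous m \<mu>"
  shows "((((\<lambda>P. semivariation (\<lambda>B. averaged_measure \<mu> m P B - m B) UNIV) \<longlongrightarrow> 0) partition_net)
        \<longleftrightarrow> compact (closure (m ` sets borel)))
    \<and> (compact (closure (m ` sets borel)) \<longleftrightarrow> compact_operator T)
    \<and> (regular_set_function (measure \<mu>) \<longrightarrow>
        (compact_operator T \<longleftrightarrow>
          (((\<lambda>P. onorm (\<lambda>f. averaged_operator \<mu> m P f - to_bidual (blinfun_apply T f))) \<longlongrightarrow> 0)
            partition_net)))"
proof -
  have \<mu>: "finite_borel_measure \<mu>"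
    using assms(3,4) by (simp add: finite_borel_measure_def finite_borel_measure_axioms_def)
  interpret finite_borel_measure \<mu> by fact
  have m: "Measure_Space.additive (sets borel) m" "weakly_regular m" "semivariation m UNIV < \<infinity>"
    and int: "\<And>f. has_vector_integral m (apply_bcontfun f) (to_bidual (blinfun_apply T f))"
    using assms(2) by (auto simp: representing_measure_def)
  obtain g where g: "\<And>\<phi>. integrable \<mu> (g \<phi>)"
    "\<And>\<phi> A. A \<in> sets borel \<Longrightarrow> blinfun_apply (m A) \<phi> = (LINT x:A|\<mu>. g \<phi> x)"
    using bidual_measure_has_density[OF m assms(5)] by metis
  show ?thesis
    using averaged_measure_tendsto_of_compact_range[OF g]
      averaged_operator_tendsto_of_averaged_measure_tendsto[OF int]
      compact_operator_of_averaged_operator_tendsto[of m T]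
      compact_range_of_compact_operator[OF \<mu> assms(1) int m(2) g]
    by blast
qed

end
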